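(* For any natural number $n$: (a) for any $m<n$ there exists $\kappa \in \mathcal{A}_j$ with $\operatorname{crit}\kappa = \gamma_{2^n-2^{m+1}}$, $\kappa(\gamma_{2^n-2^{m+1}}) = \gamma_{2^n-2^m}$, and $\kappa(\gamma_{2^n-2^m}) = \gamma_{2^n}$; (b) for $k\in\mathcal{A}_j$: if $k \bmod 2^{2^n} \ne 0$, then $k(\gamma_{2^n}) \ge \gamma_{2^{n+1}}$; if moreover $k \bmod 2^{2^{n+1}} > 2^{2^n}$ (as integers), then $k(\gamma_{2^n}) > \gamma_{2^{n+1}}$; (c) $\operatorname{crit} j_{(2^{2^n}-1)} = \gamma_0$, $j_{(2^{2^n}-1)}(\gamma_0) = \gamma_{2^n}$, and $j_{(2^{2^n}-1)}(\gamma_{2^n}) = \gamma_{2^{n+1}}$.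
   Context: Let $\lambda$ be a limit ordinal and $V_\lambda$ the collection of sets of rank less than $\lambda$. Let $\mathcal{E}_\lambda$ be the set of all nontrivial elementary embeddings $V_\lambda \to V_\lambda$, assumed nonempty, and fix $j \in \mathcal{E}_\lambda$. For $a,b \in \mathcal{E}_\lambda$ the application $a(b)$ is defined as $\bigcup_{\alpha<\lambda} a(b \restriction V_\alpha)$, again in $\mathcal{E}_\lambda$. Let $\mathcal{A}_j$ be the closure of $\{j\}$ under application. Define $j_{(1)}=j$ and $j_{(r+1)} = j_{(r)}(j)$. $\operatorname{crit} k$ is the least ordinal moved by $k$; let $\gamma_0<\gamma_1<\cdots$ be the first $\omega$ critical points of members of $\mathcal{A}_j$ in increasing order. For $N\ge 1$, $A'_N$ is the set $\{1,\dots,2^N\}$ with operation $*$ defined by: $2^N * b = b$; $a*1=a+1$ for $a<2^N$; $a*(b+1)=(a*b)*(a+1)$ for $a,b<2^N$ (a well-defined left-distributive operation). $A_N$ is $A'_N$ with $2^N$ renamed $0$, viewed as the integers $\{0,\dots,2^N-1\}$. By a theorem of Laver there is a (unique) homomorphism from $\mathcal{A}_j$ (under application) onto $A_N$ sending $j$ to $1$; the image of $k$ is denoted $k \bmod 2^N$. *)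

theory Defs
  imports Main "HOL-Library.FuncSet"
begin

text \<open>A universe of sets satisfying ZFC, with Separation and Replacement taken for arbitrary
  HOL predicates and functions. The axiom of choice is not listed: it follows from replacement
  along a HOL choice function.\<close>

class zfc_universe =
  fixes elts :: "'a \<Rightarrow> 'a set"
  assumes extensionality: "elts x = elts y \<Longrightarrow> x = y"
    and foundation: "wf {(x, y). x \<in> elts y}"
    and pairing: "\<exists>z. elts z = {x, y}"
    and union: "\<exists>z. elts z = (\<Union>y\<in>elts x. elts y)"
    and power_set: "\<exists>z. elts z = {y. elts y \<subseteq> elts x}"
    and infinity: "\<exists>z. (\<exists>e\<in>elts z. elts e = {}) \<and>
                       (\<forall>y\<in>elts z. \<exists>s\<in>elts z. elts s = insert y (elts y))"
    and separation: "X \<subseteq> elts x \<Longrightarrow> \<exists>z. elts z = X"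
    and replacement: "\<exists>z. elts z = F ` elts x"

text \<open>Meaningful only when some element of the universe has exactly the elements \<open>X\<close>.\<close>

definition vset :: "'v set \<Rightarrow> 'v::zfc_universe" where
  "vset X = (THE x. elts x = X)"

definition kpair :: "'v \<Rightarrow> 'v \<Rightarrow> 'v::zfc_universe" where
  "kpair x y = vset {vset {x}, vset {x, y}}"

definition transitive :: "'v::zfc_universe \<Rightarrow> bool" where
  "transitive x \<longleftrightarrow> (\<forall>y\<in>elts x. elts y \<subseteq> elts x)"

definition ordinal :: "'v::zfc_universe \<Rightarrow> bool" where
  "ordinal x \<longleftrightarrow> transitive x \<and> (\<forall>y\<in>elts x. transitive y)"

definition limit_ordinal :: "'v::zfc_universe \<Rightarrow> bool" where
  "limit_ordinal x \<longleftrightarrow> ordinal x \<and> elts x \<noteq> {} \<and> (\<forall>y\<in>elts x. \<exists>z\<in>elts x. y \<in> elts z)"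

definition ord_less :: "'v::zfc_universe \<Rightarrow> 'v \<Rightarrow> bool" where
  "ord_less \<alpha> \<beta> \<longleftrightarrow> \<alpha> \<in> elts \<beta>"

definition ord_le :: "'v::zfc_universe \<Rightarrow> 'v \<Rightarrow> bool" where
  "ord_le \<alpha> \<beta> \<longleftrightarrow> \<alpha> \<in> elts \<beta> \<or> \<alpha> = \<beta>"

function rank :: "'v::zfc_universe \<Rightarrow> 'v" where
  "rank x = vset (\<Union>y\<in>elts x. insert (rank y) (elts (rank y)))"
  by auto
termination
  by (relation "{(x, y). x \<in> elts y}") (auto simp: foundation)

declare rank.simps [simp del]

definition Vlevel :: "'v \<Rightarrow> 'v::zfc_universe set" where
  "Vlevel \<alpha> = {x. ord_less (rank x) \<alpha>}"

definition is_function :: "'v::zfc_universe \<Rightarrow> 'v set \<Rightarrow> 'v set \<Rightarrow> bool" where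
  "is_function f A B \<longleftrightarrow>
     elts f \<subseteq> {kpair x y | x y. x \<in> A \<and> y \<in> B} \<and> (\<forall>x\<in>A. \<exists>!y. kpair x y \<in> elts f)"

definition val :: "'v \<Rightarrow> 'v \<Rightarrow> 'v::zfc_universe" where
  "val f x = (THE y. kpair x y \<in> elts f)"

definition restr :: "'v \<Rightarrow> 'v set \<Rightarrow> 'v::zfc_universe" where
  "restr f A = vset {p \<in> elts f. \<exists>x\<in>A. \<exists>y. p = kpair x y}"

datatype fm = Mem nat nat | Equal nat nat | Neg fm | Conj fm fm | All nat fm

fun sat :: "'v::zfc_universe set \<Rightarrow> (nat \<Rightarrow> 'v) \<Rightarrow> fm \<Rightarrow> bool" where
  "sat M e (Mem i k) \<longleftrightarrow> e i \<in> elts (e k)"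
| "sat M e (Equal i k) \<longleftrightarrow> e i = e k"
| "sat M e (Neg \<phi>) \<longleftrightarrow> \<not> sat M e \<phi>"
| "sat M e (Conj \<phi> \<psi>) \<longleftrightarrow> sat M e \<phi> \<and> sat M e \<psi>"
| "sat M e (All i \<phi>) \<longleftrightarrow> (\<forall>x\<in>M. sat M (e(i := x)) \<phi>)"

definition elementary_embedding :: "'v::zfc_universe set \<Rightarrow> 'v \<Rightarrow> bool" where
  "elementary_embedding M k \<longleftrightarrow> is_function k M M \<and>
     (\<forall>\<phi> e. (\<forall>i. e i \<in> M) \<longrightarrow> (sat M e \<phi> \<longleftrightarrow> sat M (\<lambda>i. val k (e i)) \<phi>))"

definition nontrivial_embeddings :: "'v \<Rightarrow> 'v::zfc_universe set" where
  "nontrivial_embeddings \<Lambda> =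
     {k. elementary_embedding (Vlevel \<Lambda>) k \<and> (\<exists>x\<in>Vlevel \<Lambda>. val k x \<noteq> x)}"

definition appl :: "'v \<Rightarrow> 'v \<Rightarrow> 'v \<Rightarrow> 'v::zfc_universe" where
  "appl \<Lambda> a b = vset (\<Union>\<alpha>\<in>elts \<Lambda>. elts (val a (restr b (Vlevel \<alpha>))))"

inductive_set embedding_algebra :: "'v \<Rightarrow> 'v \<Rightarrow> 'v::zfc_universe set" for \<Lambda> j where
  generator: "j \<in> embedding_algebra \<Lambda> j"
| application: "a \<in> embedding_algebra \<Lambda> j \<Longrightarrow> b \<in> embedding_algebra \<Lambda> j
    \<Longrightarrow> appl \<Lambda> a b \<in> embedding_algebra \<Lambda> j"

text \<open>The left powers \<open>j\<^sub>(\<^sub>r\<^sub>)\<close>, for \<open>r \<ge> 1\<close>; the value at \<open>0\<close> is irrelevant.\<close>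

fun left_power :: "'v \<Rightarrow> 'v \<Rightarrow> nat \<Rightarrow> 'v::zfc_universe" where
  "left_power \<Lambda> j 0 = j"
| "left_power \<Lambda> j (Suc 0) = j"
| "left_power \<Lambda> j (Suc (Suc r)) = appl \<Lambda> (left_power \<Lambda> j (Suc r)) j"

text \<open>The ordinals in \<open>V\<^sub>\<lambda>\<close>, the domain of \<open>k\<close>, are the elements of \<open>\<lambda>\<close>.\<close>

definition crit :: "'v \<Rightarrow> 'v \<Rightarrow> 'v::zfc_universe" where
  "crit \<Lambda> k = (THE \<alpha>. \<alpha> \<in> elts \<Lambda> \<and> val k \<alpha> \<noteq> \<alpha> \<and>
                  (\<forall>\<beta>. ord_less \<beta> \<alpha> \<longrightarrow> val k \<beta> = \<beta>))"

definition crit_points :: "'v \<Rightarrow> 'v \<Rightarrow> 'v::zfc_universe set" where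
  "crit_points \<Lambda> j = crit \<Lambda> ` embedding_algebra \<Lambda> j"

text \<open>\<open>\<gamma>\<^sub>i\<close> is the critical point that has exactly \<open>i\<close> critical points below it.\<close>

definition gamma :: "'v \<Rightarrow> 'v \<Rightarrow> nat \<Rightarrow> 'v::zfc_universe" where
  "gamma \<Lambda> j i = (THE \<alpha>. \<alpha> \<in> crit_points \<Lambda> j \<and>
      finite {\<beta> \<in> crit_points \<Lambda> j. ord_less \<beta> \<alpha>} \<and>
      card {\<beta> \<in> crit_points \<Lambda> j. ord_less \<beta> \<alpha>} = i)"

text \<open>The operation of \<open>A'\<^sub>N\<close>; only its values on arguments in \<open>{1..2^N}\<close> matter.\<close>

function (domintros) laver :: "nat \<Rightarrow> nat \<Rightarrow> nat \<Rightarrow> nat" where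
  "laver N a b =
     (if 2 ^ N \<le> a then b
      else if b \<le> 1 then a + 1
      else laver N (laver N a (b - 1)) (a + 1))"
  by auto

lemma laver_gt: "laver_dom (N, a, b) \<Longrightarrow> a < 2 ^ N \<Longrightarrow> a < laver N a b"
proof (induction rule: laver.pinduct)
  case (1 N a b)
  show ?case
  proof (cases "b \<le> 1")
    case True
    then show ?thesis using 1 by (simp add: laver.psimps)
  next
    case False
    have c: "a < laver N a (b - 1)" using 1 False by simp
    have "laver N a b = laver N (laver N a (b - 1)) (a + 1)"
      using 1 False by (simp add: laver.psimps)
    moreover have "a < laver N (laver N a (b - 1)) (a + 1)"
    proof (cases "2 ^ N \<le> laver N a (b - 1)")
      case True
      have "laver_dom (N, laver N a (b - 1), a + 1)"
        by (rule laver.domintros) (use True in auto)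
      then show ?thesis using True by (simp add: laver.psimps)
    next
      case False
      then show ?thesis using 1 \<open>\<not> b \<le> 1\<close> c by fastforce
    qed
    ultimately show ?thesis by simp
  qed
qed

termination
  by (relation "inv_image (less_than <*lex*> less_than) (\<lambda>(N, a, b). (2 ^ N - a, b))")
    (auto dest!: laver_gt)

declare laver.simps [simp del]

lemma laver_top: "laver N (2 ^ N) b = b"
  and laver_one: "a < 2 ^ N \<Longrightarrow> laver N a 1 = a + 1"
  and laver_step: "a < 2 ^ N \<Longrightarrow> 1 \<le> b \<Longrightarrow> b < 2 ^ N \<Longrightarrow>
         laver N a (b + 1) = laver N (laver N a b) (a + 1)"
  by (subst laver.simps; simp)+

text \<open>The operation of \<open>A\<^sub>N\<close> on \<open>{0, \<dots>, 2^N - 1}\<close>, where \<open>0\<close> stands for \<open>2^N\<close>.\<close>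

definition laver0 :: "nat \<Rightarrow> nat \<Rightarrow> nat \<Rightarrow> nat" where
  "laver0 N a b =
     (let c = laver N (if a = 0 then 2 ^ N else a) (if b = 0 then 2 ^ N else b)
      in if c = 2 ^ N then 0 else c)"

text \<open>Homomorphisms from the algebra generated by \<open>j\<close> onto \<open>A\<^sub>N\<close> sending \<open>j\<close> to \<open>1\<close>, made
  extensional so that there is only one as a HOL function.\<close>

definition laver_hom :: "'v::zfc_universe \<Rightarrow> 'v \<Rightarrow> nat \<Rightarrow> ('v \<Rightarrow> nat) \<Rightarrow> bool" where
  "laver_hom \<Lambda> j N h \<longleftrightarrow>
     h \<in> extensional (embedding_algebra \<Lambda> j) \<and>
     h ` embedding_algebra \<Lambda> j = {0..<2 ^ N} \<and>
     h j = 1 \<and>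
     (\<forall>a\<in>embedding_algebra \<Lambda> j. \<forall>b\<in>embedding_algebra \<Lambda> j.
        h (appl \<Lambda> a b) = laver0 N (h a) (h b))"

text \<open>\<open>k mod 2^N\<close>, for \<open>N \<ge> 1\<close>.\<close>

definition emb_mod :: "'v::zfc_universe \<Rightarrow> 'v \<Rightarrow> nat \<Rightarrow> 'v \<Rightarrow> nat" where
  "emb_mod \<Lambda> j N k = (THE h. laver_hom \<Lambda> j N h) k"

end

theory Submission
  imports Defs "HOL-Library.Extended_Nat"
begin

text \<open>Write \<open>k \<cdot> l\<close> for application. Since \<open>k \<cdot> l\<close> has critical point \<open>k(crit l)\<close>, everything said
  about values at the \<open>\<gamma>\<^sub>i\<close> is a statement about critical points of products, and only the left
  distributive law and the order behaviour of \<open>crit\<close> matter. Call two elements equivalent at \<open>\<gamma>\<^sub>N\<close> if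
  they are related by the congruence that identifies \<open>x \<cdot> b\<close> with \<open>b\<close> whenever \<open>crit x \<ge> \<gamma>\<^sub>N\<close>;
  equivalent elements have the same critical point below \<open>\<gamma>\<^sub>N\<close>. This gives Laver's theorem that
  \<open>crit j\<^bsub>(2^N)\<^esub> = \<gamma>\<^sub>N\<close> and that the quotient at \<open>\<gamma>\<^sub>N\<close> is \<open>A\<^sub>N\<close>.

  Parts (a), (b), (c) are proved together by induction on \<open>n\<close>. Given (a) and \<open>K = 2^n\<close>, part (b) follows
  by descending induction on \<open>k mod 2^K\<close> (respectively \<open>k mod 2^(2K)\<close>): if \<open>k(\<gamma>\<^sub>0) < \<gamma>\<^sub>K\<close>, some \<open>\<kappa>\<close>
  from (a) gives \<open>k(\<gamma>\<^sub>K) \<ge> (k \<cdot> \<kappa>)(\<gamma>\<^sub>K)\<close> with \<open>crit (k \<cdot> \<kappa>) < \<gamma>\<^sub>K\<close>, and \<open>k \<cdot> \<kappa>\<close> has a larger residue.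
  Part (b) computes the products \<open>j\<^bsub>(q 2^K)\<^esub> \<cdot> j\<^bsub>(r)\<^esub>\<close> up to \<open>\<gamma>\<^bsub>2K+1\<^esub>\<close>, which is (c). By (c) the embedding
  \<open>l = j\<^bsub>(2^K - 1)\<^esub>\<close> maps \<open>\<gamma>\<^sub>i\<close> to \<open>\<gamma>\<^bsub>K+i\<^esub>\<close> for \<open>i \<le> K\<close>, so \<open>l\<close> and the \<open>l \<cdot> \<kappa>\<close> witness (a) for \<open>n + 1\<close>.

  Application is not shown to preserve full elementarity; it preserves the truth of bounded
  formulas over \<open>\<in>\<close>, pairing and the levels \<open>V\<^sub>\<alpha>\<close>, and that is all the argument needs.\<close>

section \<open>Algebra of critical points\<close>

lemma laver_le: "a \<le> 2 ^ N \<Longrightarrow> b \<le> 2 ^ N \<Longrightarrow> laver N a b \<le> 2 ^ N"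
proof (induction N a b rule: laver.induct)
  case (1 N a b)
  show ?case
  proof (cases "2 ^ N \<le> a \<or> b \<le> 1")
    case True
    then show ?thesis using 1 by (subst laver.simps) auto
  next
    case False
    then have "laver N a b = laver N (laver N a (b - 1)) (a + 1)" by (subst laver.simps) simp
    then show ?thesis using 1 False by simp
  qed
qed

lemma laver_greater: "a < 2 ^ N \<Longrightarrow> a < laver N a b"
proof (induction N a b rule: laver.induct)
  case (1 N a b)
  show ?case
  proof (cases "b \<le> 1")
    case True
    then show ?thesis using 1 by (subst laver.simps) simp
  next
    case False
    then have e: "laver N a b = laver N (laver N a (b - 1)) (a + 1)"
      using 1 by (subst laver.simps) simp
    have lt: "a < laver N a (b - 1)" using 1 False by simp
    show ?thesis
    proof (cases "2 ^ N \<le> laver N a (b - 1)")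
      case True
      then show ?thesis unfolding e by (subst laver.simps) simp
    next
      case False
      then show ?thesis unfolding e using "1.IH"(2) "1.prems" \<open>\<not> b \<le> 1\<close> lt by fastforce
    qed
  qed
qed

lemma laver_pos: "1 \<le> b \<Longrightarrow> 1 \<le> laver N a b"
proof (cases "a < 2 ^ N")
  case True
  then show ?thesis using laver_greater[of a N b] by simp
next
  case False
  then show "1 \<le> b \<Longrightarrow> ?thesis" by (subst laver.simps) simp
qed

text \<open>\<open>c a = i\<close> stands for \<open>crit a = \<gamma>\<^sub>i\<close>. Critical points beyond the first \<open>\<omega>\<close> all get the value \<open>\<infinity>\<close>,
  where strict monotonicity is lost; this is why it is stated with \<open>eSuc\<close>.\<close>

locale crit_algebra =
  fixes A :: "'a set" and app :: "'a \<Rightarrow> 'a \<Rightarrow> 'a" (infixl "\<cdot>" 70)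
    and j :: 'a and c :: "'a \<Rightarrow> enat"
  assumes j_in: "j \<in> A"
    and app_in: "a \<in> A \<Longrightarrow> b \<in> A \<Longrightarrow> a \<cdot> b \<in> A"
    and generated: "k \<in> A \<Longrightarrow> P j \<Longrightarrow>
          (\<And>a b. a \<in> A \<Longrightarrow> b \<in> A \<Longrightarrow> P a \<Longrightarrow> P b \<Longrightarrow> P (a \<cdot> b)) \<Longrightarrow> P k"
    and ldist: "x \<in> A \<Longrightarrow> y \<in> A \<Longrightarrow> z \<in> A \<Longrightarrow> x \<cdot> (y \<cdot> z) = (x \<cdot> y) \<cdot> (x \<cdot> z)"
    and c_strict: "a \<in> A \<Longrightarrow> x \<in> A \<Longrightarrow> y \<in> A \<Longrightarrow> c x < c y \<Longrightarrow> eSuc (c (a \<cdot> x)) \<le> c (a \<cdot> y)"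
    and c_cong: "a \<in> A \<Longrightarrow> x \<in> A \<Longrightarrow> y \<in> A \<Longrightarrow> c x = c y \<Longrightarrow> c (a \<cdot> x) = c (a \<cdot> y)"
    and c_below: "a \<in> A \<Longrightarrow> x \<in> A \<Longrightarrow> c x < c a \<Longrightarrow> c (a \<cdot> x) = c x"
    and c_self: "a \<in> A \<Longrightarrow> eSuc (c a) \<le> c (a \<cdot> a)"
    and c_ge: "a \<in> A \<Longrightarrow> x \<in> A \<Longrightarrow> c x \<le> c (a \<cdot> x)"
    and c_onto: "\<exists>x\<in>A. c x = enat i"
begin

section \<open>Values of an embedding at the critical points\<close>

lemma c_mono: "a \<in> A \<Longrightarrow> x \<in> A \<Longrightarrow> y \<in> A \<Longrightarrow> c x \<le> c y \<Longrightarrow> c (a \<cdot> x) \<le> c (a \<cdot> y)"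
  by (metis c_strict c_cong order_le_less ile_eSuc order_trans)

text \<open>Every intermediate index is attained by \<open>c_onto\<close>, and each one forces a
  further strict step of the values. An embedding therefore never brings two of the \<gamma>_i
  closer together.\<close>

lemma c_shift:
  assumes "a \<in> A" "x \<in> A" "y \<in> A" "c x = enat i" "enat (i + t) \<le> c y"
  shows "c (a \<cdot> x) + enat t \<le> c (a \<cdot> y)"
  using assms(3,5)
proof (induction t arbitrary: y)
  case 0
  then show ?case using assms c_mono by (simp add: zero_enat_def[symmetric])
next
  case (Suc t)
  obtain z where z: "z \<in> A" "c z = enat (i + t)" using c_onto by blast
  have "c (a \<cdot> x) + enat t \<le> c (a \<cdot> z)" using Suc.IH z by simp
  moreover have "c z < c y" using Suc.prems z
    by (metis add_Suc_right enat_ord_simps(2) less_le_trans lessI)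
  then have "eSuc (c (a \<cdot> z)) \<le> c (a \<cdot> y)" using c_strict assms(1) z Suc.prems by blast
  ultimately have "eSuc (c (a \<cdot> x) + enat t) \<le> c (a \<cdot> y)"
    by (meson eSuc_ile_mono order_trans)
  then show ?case by (simp add: eSuc_enat[symmetric] iadd_Suc_right)
qed

text \<open>At the critical point itself \<open>c_self\<close> gains one step, and
  \<open>c_shift\<close> carries this gain up to every later \<gamma>_i.\<close>

lemma c_moves:
  assumes "a \<in> A" "y \<in> A" "c a \<le> enat i" "enat i \<le> c y"
  shows "enat (Suc i) \<le> c (a \<cdot> y)"
proof -
  obtain r where r: "c a = enat r" using assms(3) by (cases "c a") auto
  then have ri: "r \<le> i" using assms by simp
  have "c (a \<cdot> a) + enat (i - r) \<le> c (a \<cdot> y)"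
    by (rule c_shift[OF assms(1) assms(1) assms(2) r]) (use ri assms in simp)
  moreover have "enat (Suc r) \<le> c (a \<cdot> a)" using c_self[OF assms(1)] r by (simp add: eSuc_enat)
  then have "enat (Suc r) + enat (i - r) \<le> c (a \<cdot> a) + enat (i - r)" by (rule add_right_mono)
  ultimately have "enat (Suc r) + enat (i - r) \<le> c (a \<cdot> y)" by (meson order_trans)
  then show ?thesis using ri by simp
qed

section \<open>The congruence at a critical point\<close>

inductive eqv :: "enat \<Rightarrow> 'a \<Rightarrow> 'a \<Rightarrow> bool" for g where
  eqv_refl: "a \<in> A \<Longrightarrow> eqv g a a"
| eqv_sym: "eqv g a b \<Longrightarrow> eqv g b a"
| eqv_trans: "eqv g a b \<Longrightarrow> eqv g b d \<Longrightarrow> eqv g a d"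
| eqv_base: "x \<in> A \<Longrightarrow> b \<in> A \<Longrightarrow> g \<le> c x \<Longrightarrow> eqv g (x \<cdot> b) b"
| eqv_left: "eqv g a b \<Longrightarrow> d \<in> A \<Longrightarrow> eqv g (a \<cdot> d) (b \<cdot> d)"

lemma eqv_in: "eqv g a b \<Longrightarrow> a \<in> A \<and> b \<in> A"
  by (induction rule: eqv.induct) (auto simp: app_in)

lemma eqv_le: "eqv g a b \<Longrightarrow> g' \<le> g \<Longrightarrow> eqv g' a b"
proof (induction rule: eqv.induct)
  case (eqv_trans a b d)
  then show ?case by (blast intro: eqv.eqv_trans)
qed (auto intro: eqv.intros)

text \<open>Only factors on the right are built into \<open>eqv\<close>; this supplies the other
  side. Distributing k turns a generating pair x \<cdot> b, b into (k \<cdot> x) \<cdot> (k \<cdot>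
  b), k \<cdot> b, where k \<cdot> x lies as high as k \<cdot> u. Agreement up to \<gamma> is thus
  stretched to agreement up to k(\<gamma>), which later pushes congruences beyond the level where
  they start.\<close>

lemma eqv_right_strong:
  assumes "eqv (c u) a b" "u \<in> A" "k \<in> A"
  shows "eqv (c (k \<cdot> u)) (k \<cdot> a) (k \<cdot> b)"
  using assms(1)
proof (induction rule: eqv.induct)
  case (eqv_trans a b d)
  then show ?case by (blast intro: eqv.eqv_trans)
next
  case (eqv_base x b)
  then show ?case using assms by (simp add: ldist[of k x b] c_mono app_in eqv.eqv_base)
next
  case (eqv_left a b d)
  then show ?case using assms eqv_in[of "c u" a b] by (simp add: ldist[of k a d] ldist[of k b d] app_in eqv.eqv_left)
qed (auto intro: eqv.intros app_in assms)

lemma eqv_right_add: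
  assumes "eqv (enat i) a b" "u \<in> A" "c u = enat i" "k \<in> A" "g \<le> c (k \<cdot> u)"
  shows "eqv g (k \<cdot> a) (k \<cdot> b)"
  using eqv_right_strong[of u a b k] assms eqv_le by simp

lemma eqv_app:
  assumes "eqv (enat i) a b" "eqv (enat i) a' b'"
  shows "eqv (enat i) (a \<cdot> a') (b \<cdot> b')"
proof -
  obtain u where u: "u \<in> A" "c u = enat i" using c_onto by blast
  have "eqv (enat i) (a \<cdot> a') (a \<cdot> b')"
    by (rule eqv_right_add[OF assms(2) u]) (use assms eqv_in c_ge u in metis)+
  then show ?thesis using assms eqv_in by (meson eqv_left eqv_trans)
qed

lemma foldl_in: "a \<in> A \<Longrightarrow> set ds \<subseteq> A \<Longrightarrow> foldl (\<cdot>) a ds \<in> A"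
  by (induction ds arbitrary: a) (auto simp: app_in)

lemma foldl_ldist:
  "x \<in> A \<Longrightarrow> b \<in> A \<Longrightarrow> set ds \<subseteq> A \<Longrightarrow>
    x \<cdot> foldl (\<cdot>) b ds = foldl (\<cdot>) (x \<cdot> b) (map ((\<cdot>) x) ds)"
proof (induction ds arbitrary: b)
  case (Cons d ds)
  then show ?case using Cons.IH[of "b \<cdot> d"] by (simp add: app_in ldist[of x b d])
qed simp

lemma min_c_app:
  assumes "x \<in> A" "b \<in> A" "g \<le> c x"
  shows "min g (c (x \<cdot> b)) = min g (c b)"
proof (cases "c b < c x")
  case True
  then show ?thesis using assms c_below by simp
next
  case False
  then have "g \<le> c b" "g \<le> c (x \<cdot> b)" using assms c_ge by (meson linorder_not_less order_trans)+
  then show ?thesis by (simp add: min_absorb1)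
qed

text \<open>Distributing \<open>x\<close> replaces every \<open>d\<close> of the context by \<open>x \<cdot> d\<close>. These are changed back from left
  to right: as \<open>u \<cdot> (x \<cdot> d) = (u \<cdot> x) \<cdot> (u \<cdot> d)\<close> with \<open>crit (u \<cdot> x) \<ge> crit x\<close>, each change is an
  instance of the claim with a shorter context.\<close>

lemma min_c_foldl:
  assumes "x \<in> A" "b \<in> A" "g \<le> c x" "set ds \<subseteq> A"
  shows "min g (c (foldl (\<cdot>) (x \<cdot> b) ds)) = min g (c (foldl (\<cdot>) b ds))"
  using assms
proof (induction "length ds" arbitrary: x b ds rule: less_induct)
  case less
  have step: "min g (c (foldl (\<cdot>) u (map ((\<cdot>) x) es))) = min g (c (foldl (\<cdot>) u es))"
    if "u \<in> A" "set es \<subseteq> A" "length es \<le> length ds" for u es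
    using that
  proof (induction es arbitrary: u)
    case (Cons d es)
    have "u \<cdot> (x \<cdot> d) = (u \<cdot> x) \<cdot> (u \<cdot> d)" using Cons.prems less.prems ldist[of u x d] by simp
    moreover have "g \<le> c (u \<cdot> x)" using Cons.prems less.prems c_ge order_trans by blast
    ultimately have "min g (c (foldl (\<cdot>) (u \<cdot> (x \<cdot> d)) es)) = min g (c (foldl (\<cdot>) (u \<cdot> d) es))"
      using less.hyps[of es "u \<cdot> x" "u \<cdot> d"] Cons.prems less.prems app_in by simp
    moreover have "min g (c (foldl (\<cdot>) (u \<cdot> (x \<cdot> d)) (map ((\<cdot>) x) es)))
        = min g (c (foldl (\<cdot>) (u \<cdot> (x \<cdot> d)) es))"
      using Cons less.prems app_in by simp
    ultimately show ?case by simp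
  qed simp
  have "min g (c (foldl (\<cdot>) (x \<cdot> b) ds)) = min g (c (x \<cdot> foldl (\<cdot>) b ds))"
    using step[of "x \<cdot> b" ds] less.prems foldl_ldist app_in by simp
  also have "\<dots> = min g (c (foldl (\<cdot>) b ds))"
    using less.prems min_c_app foldl_in by simp
  finally show ?case .
qed

text \<open>The claim is made for all contexts \<open>ds\<close> because \<open>eqv_left\<close>
  appends a factor on the right; in the induction that factor is moved to the front of the
  context.\<close>

lemma eqv_min_c_foldl:
  "eqv g a b \<Longrightarrow> set ds \<subseteq> A \<Longrightarrow> min g (c (foldl (\<cdot>) a ds)) = min g (c (foldl (\<cdot>) b ds))"
proof (induction arbitrary: ds rule: eqv.induct)
  case (eqv_base x b)
  then show ?case using min_c_foldl by blast
next
  case (eqv_left a b d)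
  then show ?case using eqv_left.IH[of "d # ds"] by simp
qed auto

lemma eqv_min_c: "eqv g a b \<Longrightarrow> min g (c a) = min g (c b)"
  using eqv_min_c_foldl[of g a b "[]"] by simp

lemma eqv_c_ge: "eqv g a b \<Longrightarrow> g' \<le> g \<Longrightarrow> g' \<le> c a \<longleftrightarrow> g' \<le> c b"
  using eqv_min_c by (metis min.bounded_iff)

section \<open>Left powers and Laver's theorem\<close>

fun lp :: "'a \<Rightarrow> nat \<Rightarrow> 'a" where
  "lp x 0 = x"
| "lp x (Suc 0) = x"
| "lp x (Suc (Suc r)) = lp x (Suc r) \<cdot> x"

lemma lp_Suc: "1 \<le> r \<Longrightarrow> lp x (Suc r) = lp x r \<cdot> x"
  by (cases r) auto

lemma lp_in: "x \<in> A \<Longrightarrow> lp x r \<in> A"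
  by (induction x r rule: lp.induct) (auto simp: app_in)

lemma lp_j_in [simp]: "lp j r \<in> A"
  by (simp add: lp_in j_in)

text \<open>This is why left powers of bases other than j are considered:
  \<open>left_power_values\<close> uses it to turn l \<cdot> \<open>lp j (2 ^ K)\<close> into a left
  power of \<open>lp j (2 ^ K)\<close>.\<close>

lemma app_lp: "k \<in> A \<Longrightarrow> x \<in> A \<Longrightarrow> k \<cdot> lp x r = lp (k \<cdot> x) r"
  by (induction x r rule: lp.induct) (auto simp: ldist[of k "lp x (Suc r)" x for x r] lp_in)

text \<open>Left distributivity turns \<open>lp j p\<close> \<cdot> \<open>lp j q\<close> into
  (\<open>lp j p\<close> \<cdot> \<open>lp j (q - 1)\<close>) \<cdot> \<open>lp j (p + 1)\<close>,
  the recursion of \<open>laver\<close>; for p = 2^N the left factor acts as the identity in the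
  congruence. The parameters \<open>i\<close> and \<open>N\<close> are independent because
  \<open>c_lp_aux\<close> uses i = N + 1 to reach a contradiction.\<close>

lemma lp_laver:
  assumes "enat i \<le> c (lp j (2 ^ N))"
  shows "1 \<le> p \<Longrightarrow> p \<le> 2 ^ N \<Longrightarrow> 1 \<le> q \<Longrightarrow> q \<le> 2 ^ N \<Longrightarrow>
           eqv (enat i) (lp j p \<cdot> lp j q) (lp j (laver N p q))"
  using assms
proof (induction N p q rule: laver.induct)
  case (1 N p q)
  consider "p = 2 ^ N" | "p < 2 ^ N" "q = 1" | "p < 2 ^ N" "q > 1" using 1 by linarith
  then show ?case
  proof cases
    case 1
    then show ?thesis using "1.prems" by (simp add: laver_top eqv_base)
  next
    case 2
    then show ?thesis using "1.prems" laver_one[of p N] lp_Suc[of p j] by (simp add: eqv_refl app_in j_in)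
  next
    case 3
    define r where "r = laver N p (q - 1)"
    have r: "1 \<le> r" "r \<le> 2 ^ N" using 3 "1.prems" laver_pos laver_le unfolding r_def by auto
    have e: "laver N p q = laver N r (p + 1)" using 3 by (subst laver.simps) (simp add: r_def)
    have "lp j p \<cdot> lp j q = lp j p \<cdot> (lp j (q - 1) \<cdot> j)" using lp_Suc[of "q - 1" j] 3 by simp
    also have "\<dots> = (lp j p \<cdot> lp j (q - 1)) \<cdot> lp j (p + 1)"
      using lp_Suc[of p j] "1.prems" ldist[of "lp j p" "lp j (q - 1)" j] by (simp add: j_in)
    finally have *: "lp j p \<cdot> lp j q = (lp j p \<cdot> lp j (q - 1)) \<cdot> lp j (p + 1)" .
    have "eqv (enat i) (lp j p \<cdot> lp j (q - 1)) (lp j r)"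
      using "1.IH"(1) 3 "1.prems" unfolding r_def by simp
    then have "eqv (enat i) (lp j p \<cdot> lp j q) (lp j r \<cdot> lp j (p + 1))"
      unfolding * by (simp add: eqv_left)
    moreover have "eqv (enat i) (lp j r \<cdot> lp j (p + 1)) (lp j (laver N r (p + 1)))"
      using "1.IH"(2) 3 "1.prems" r unfolding r_def by simp
    ultimately show ?thesis unfolding e by (rule eqv_trans)
  qed
qed

lemma eqv_lp_exists:
  assumes "enat i \<le> c (lp j (2 ^ N))" "k \<in> A"
  shows "\<exists>p. 1 \<le> p \<and> p \<le> 2 ^ N \<and> eqv (enat i) k (lp j p)"
proof (rule generated[OF assms(2)])
  show "\<exists>p. 1 \<le> p \<and> p \<le> 2 ^ N \<and> eqv (enat i) j (lp j p)"
    by (intro exI[of _ 1]) (simp add: eqv_refl j_in)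
next
  fix a b
  assume "a \<in> A" "b \<in> A"
    and "\<exists>p. 1 \<le> p \<and> p \<le> 2 ^ N \<and> eqv (enat i) a (lp j p)"
    and "\<exists>p. 1 \<le> p \<and> p \<le> 2 ^ N \<and> eqv (enat i) b (lp j p)"
  then obtain p q where p: "1 \<le> p" "p \<le> 2 ^ N" "eqv (enat i) a (lp j p)"
    and q: "1 \<le> q" "q \<le> 2 ^ N" "eqv (enat i) b (lp j q)" by blast
  have "eqv (enat i) (a \<cdot> b) (lp j (laver N p q))"
    using eqv_app[OF p(3) q(3)] lp_laver[OF assms(1) p(1,2) q(1,2)] by (rule eqv_trans)
  then show "\<exists>p. 1 \<le> p \<and> p \<le> 2 ^ N \<and> eqv (enat i) (a \<cdot> b) (lp j p)"
    using laver_pos[OF q(1)] laver_le[OF p(2) q(2)] by blast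
qed

lemma eqv_lp_add:
  assumes "eqv g (lp j p) (lp j q)" "1 \<le> p" "1 \<le> q"
  shows "eqv g (lp j (p + t)) (lp j (q + t))"
proof (induction t)
  case (Suc t)
  then show ?case using assms lp_Suc[of "p + t" j] lp_Suc[of "q + t" j] eqv_left j_in by simp
qed (use assms in simp)

text \<open>The power with exponent m + 1 is \<open>lp j m\<close> \<cdot> j, which is equivalent to
  j; multiplying both by j repeatedly gives the period m.\<close>

lemma eqv_lp_period:
  assumes "g \<le> c (lp j m)" "1 \<le> m" "1 \<le> p"
  shows "eqv g (lp j (p + s * m)) (lp j p)"
proof -
  have one: "eqv g (lp j (q + m)) (lp j q)" if "1 \<le> q" for q
  proof -
    have "eqv g (lp j (Suc m)) (lp j 1)" using assms by (simp add: lp_Suc eqv_base j_in)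
    then have "eqv g (lp j (Suc m + (q - 1))) (lp j (1 + (q - 1)))"
      using eqv_lp_add[of g "Suc m" 1 "q - 1"] by simp
    then show ?thesis using that by (simp add: add.commute)
  qed
  show ?thesis
  proof (induction s)
    case 0
    then show ?case by (simp add: eqv_refl)
  next
    case (Suc s)
    have "eqv g (lp j (p + s * m + m)) (lp j (p + s * m))" using one assms by simp
    then show ?case using Suc eqv_trans by (simp add: algebra_simps)
  qed
qed

text \<open>For the induction step, the index of a = \<open>lp j (2 ^ N)\<close> is first pinned to
  N. Up to \<gamma>_(N+1), multiplication by a then shifts exponents by 2^N, so a \<cdot> a is
  equivalent to \<open>lp j (2 ^ Suc N)\<close>, and its critical point lies above
  \<gamma>_N.\<close>

lemma c_lp_aux:
  "enat N \<le> c (lp j (2 ^ N)) \<and> (\<forall>p. 1 \<le> p \<and> p < 2 ^ N \<longrightarrow> c (lp j p) < enat N)"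
proof (induction N)
  case 0
  then show ?case by (simp add: zero_enat_def[symmetric])
next
  case (Suc N)
  let ?a = "lp j (2 ^ N)"
  obtain k where k: "k \<in> A" "c k = enat N" using c_onto by blast
  \<comment> \<open>Otherwise every element would be equivalent at \<gamma>_(N+1) to a left power
    with exponent at most 2^N, and none of these would have index exactly N.\<close>
  have "\<not> enat (Suc N) \<le> c ?a"
  proof
    assume "enat (Suc N) \<le> c ?a"
    then obtain p where p: "1 \<le> p" "p \<le> 2 ^ N" "eqv (enat (Suc N)) k (lp j p)"
      using eqv_lp_exists k by blast
    then have "enat N \<le> c (lp j p)" "\<not> enat (Suc N) \<le> c (lp j p)"
      using eqv_c_ge[OF p(3), of "enat N"] eqv_c_ge[OF p(3), of "enat (Suc N)"] k by auto
    then show False using Suc p \<open>enat (Suc N) \<le> c ?a\<close> by (metis le_neq_implies_less linorder_not_le)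
  qed
  then have a: "c ?a = enat N" using Suc by (metis Suc_ile_eq order_le_less)
  have per: "eqv (enat N) (lp j (2 ^ N + q)) (lp j q)" if "1 \<le> q" for q
    using eqv_lp_period[of "enat N" "2 ^ N" q 1] Suc that by (simp add: add.commute)
  have small: "c (lp j p) < enat N" if "1 \<le> p" "p < 2 ^ Suc N" "p \<noteq> 2 ^ N" for p
  proof (cases "p < 2 ^ N")
    case False
    then have "eqv (enat N) (lp j p) (lp j (p - 2 ^ N))" "1 \<le> p - 2 ^ N" "p - 2 ^ N < 2 ^ N"
      using per[of "p - 2 ^ N"] that by auto
    then show ?thesis using Suc eqv_c_ge by (metis linorder_not_le order_refl)
  qed (use Suc that in blast)
  have "eqv (enat (Suc N)) (?a \<cdot> lp j (Suc q)) (lp j (2 ^ N + Suc q))" if "q < 2 ^ N" for q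
    using that
  proof (induction q)
    case 0
    then show ?case by (simp add: lp_Suc eqv_refl app_in j_in)
  next
    case (Suc q)
    let ?x = "lp j (2 ^ N + Suc q)"
    have x: "c ?x < enat N" using small Suc.prems by simp
    \<comment> \<open>The right factors agree only at \<gamma>_N, but x has a smaller critical point
      and so moves \<gamma>_N; the products agree at \<gamma>_(N+1).\<close>
    have "eqv (enat (Suc N)) (?x \<cdot> lp j (2 ^ N + 1)) (?x \<cdot> lp j 1)"
      by (rule eqv_right_add[OF per, of _ ?a]) (use a x c_moves in simp_all)
    moreover have "?a \<cdot> lp j (Suc (Suc q)) = (?a \<cdot> lp j (Suc q)) \<cdot> lp j (2 ^ N + 1)"
      using ldist[of ?a "lp j (Suc q)" j] by (simp add: lp_Suc j_in)
    moreover have "eqv (enat (Suc N)) ((?a \<cdot> lp j (Suc q)) \<cdot> lp j (2 ^ N + 1)) (?x \<cdot> lp j (2 ^ N + 1))"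
      using Suc by (simp add: eqv_left)
    moreover have "?x \<cdot> lp j 1 = lp j (2 ^ N + Suc (Suc q))" by simp
    ultimately show ?case by (metis eqv_trans)
  qed
  from this[of "2 ^ N - 1"] have "eqv (enat (Suc N)) (?a \<cdot> ?a) (lp j (2 ^ Suc N))"
    by (simp add: mult_2)
  moreover have "enat (Suc N) \<le> c (?a \<cdot> ?a)" using c_moves a by simp
  ultimately have "enat (Suc N) \<le> c (lp j (2 ^ Suc N))" using eqv_c_ge by blast
  moreover have "c (lp j p) < enat (Suc N)" if "1 \<le> p" "p < 2 ^ Suc N" for p
    using small[OF that] a by (cases "p = 2 ^ N") (auto intro: less_trans)
  ultimately show ?case by blast
qed

text \<open>By periodicity p may be replaced by its residue in 1..2^i, and of these exponents
  \<open>c_lp_aux\<close> leaves only 2^i.\<close>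

lemma c_lp_ge_iff: "1 \<le> p \<Longrightarrow> enat i \<le> c (lp j p) \<longleftrightarrow> 2 ^ i dvd p"
proof -
  assume p: "1 \<le> p"
  define s r where "s = (p - 1) div 2 ^ i" and "r = (p - 1) mod 2 ^ i + 1"
  have pr: "p = r + s * 2 ^ i" using p div_mult_mod_eq[of "p - 1" "2 ^ i"] unfolding s_def r_def by linarith
  have r: "1 \<le> r" "r \<le> 2 ^ i" unfolding r_def by (auto simp: Suc_le_eq)
  have "eqv (enat i) (lp j p) (lp j r)"
    unfolding pr by (rule eqv_lp_period) (use c_lp_aux r in auto)
  then have "enat i \<le> c (lp j p) \<longleftrightarrow> enat i \<le> c (lp j r)" using eqv_c_ge by blast
  also have "\<dots> \<longleftrightarrow> r = 2 ^ i" using c_lp_aux[of i] r by (metis le_neq_implies_less linorder_not_le)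
  also have "\<dots> \<longleftrightarrow> 2 ^ i dvd r" using r by (metis dvd_imp_le dvd_refl le_antisym less_le_trans zero_less_one)
  also have "\<dots> \<longleftrightarrow> 2 ^ i dvd p" unfolding pr by (simp add: dvd_add_left_iff)
  finally show ?thesis .
qed

lemma c_lp_pow: "c (lp j (2 ^ i)) = enat i"
proof -
  have "\<not> enat (Suc i) \<le> c (lp j (2 ^ i))" by (subst c_lp_ge_iff) (auto dest: dvd_imp_le)
  moreover have "enat i \<le> c (lp j (2 ^ i))" by (simp add: c_lp_ge_iff)
  ultimately show ?thesis by (metis Suc_ile_eq order_le_less)
qed

text \<open>If p < q, multiplying on the right by j, 2^N - q times, would make
  \<open>lp j (2 ^ N)\<close> equivalent to a left power with a smaller exponent, which has too
  small a critical point.\<close>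

lemma eqv_lp_unique:
  assumes "eqv (enat N) (lp j p) (lp j q)" "1 \<le> p" "p \<le> 2 ^ N" "1 \<le> q" "q \<le> 2 ^ N"
  shows "p = q"
proof -
  have "\<not> p < q" if "eqv (enat N) (lp j p) (lp j q)" "1 \<le> p" "q \<le> 2 ^ N" for p q
  proof
    assume "p < q"
    have "eqv (enat N) (lp j (p + (2 ^ N - q))) (lp j (2 ^ N))"
      using eqv_lp_add[OF that(1,2), of "2 ^ N - q"] that \<open>p < q\<close> by simp
    then have "2 ^ N dvd p + (2 ^ N - q)"
      using eqv_c_ge c_lp_pow c_lp_ge_iff that(2) by (metis order_refl trans_le_add1)
    then show False using that \<open>p < q\<close> by (auto dest: dvd_imp_le)
  qed
  then show ?thesis using assms eqv_sym by (meson linorder_neqE_nat)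
qed

section \<open>Residues in the range 1..2^N\<close>

definition md :: "nat \<Rightarrow> 'a \<Rightarrow> nat" where
  "md N k = (THE p. 1 \<le> p \<and> p \<le> 2 ^ N \<and> eqv (enat N) k (lp j p))"

lemma md_unique: "1 \<le> p \<Longrightarrow> p \<le> 2 ^ N \<Longrightarrow> eqv (enat N) k (lp j p) \<Longrightarrow> md N k = p"
  unfolding md_def by (rule the_equality) (blast intro: eqv_lp_unique eqv_sym eqv_trans)+

lemma md: "k \<in> A \<Longrightarrow> 1 \<le> md N k \<and> md N k \<le> 2 ^ N \<and> eqv (enat N) k (lp j (md N k))"
proof -
  assume "k \<in> A"
  then obtain p where "1 \<le> p" "p \<le> 2 ^ N" "eqv (enat N) k (lp j p)"
    using eqv_lp_exists[of N N k] c_lp_pow[of N] by auto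
  then show ?thesis using md_unique[of p N k] by simp
qed

lemma md_lp: "1 \<le> p \<Longrightarrow> p \<le> 2 ^ N \<Longrightarrow> md N (lp j p) = p"
  by (rule md_unique) (auto simp: eqv_refl)

lemma md_app:
  assumes "a \<in> A" "b \<in> A"
  shows "md N (a \<cdot> b) = laver N (md N a) (md N b)"
proof (rule md_unique)
  show "eqv (enat N) (a \<cdot> b) (lp j (laver N (md N a) (md N b)))"
    by (rule eqv_trans[OF eqv_app lp_laver]) (use md[OF assms(1), of N] md[OF assms(2), of N] in \<open>auto simp: c_lp_pow\<close>)
qed (use assms md laver_pos laver_le in auto)

text \<open>The residue serves as a measure: passing from k to a product k \<cdot> y brings it
  closer to 2^N. The inductions in \<open>value_ge\<close> and \<open>value_gt\<close> run along
  it.\<close>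

lemma md_app_gt: "a \<in> A \<Longrightarrow> b \<in> A \<Longrightarrow> md N a < 2 ^ N \<Longrightarrow> md N a < md N (a \<cdot> b)"
  by (simp add: md_app laver_greater)

lemma c_ge_iff_md: "k \<in> A \<Longrightarrow> i \<le> N \<Longrightarrow> enat i \<le> c k \<longleftrightarrow> 2 ^ i dvd md N k"
  using md[of k N] eqv_c_ge[of "enat N" k "lp j (md N k)" "enat i"] c_lp_ge_iff[of "md N k" i] by simp

text \<open>The residue 2^N is the 0 of A_N, so this translates the hypothesis of part (b) into one
  about critical points.\<close>

lemma c_less_iff_md: "k \<in> A \<Longrightarrow> c k < enat N \<longleftrightarrow> md N k < 2 ^ N"
proof -
  assume k: "k \<in> A"
  have "2 ^ N dvd md N k \<longleftrightarrow> \<not> md N k < 2 ^ N"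
    using md[OF k, of N] dvd_imp_le[of "2 ^ N" "md N k"] by (auto simp: not_less)
  then show ?thesis using c_ge_iff_md[OF k, of N N] by (auto simp: not_le)
qed

text \<open>Since k(crit x) = crit (k \<cdot> x) and \<open>lp j (2 ^ i)\<close> has critical point
  \<gamma>_i, this encodes k(\<gamma>_i) = \<gamma>_m within the algebra.\<close>

definition maps_to :: "'a \<Rightarrow> nat \<Rightarrow> nat \<Rightarrow> bool" where
  "maps_to k i m \<longleftrightarrow> c (k \<cdot> lp j (2 ^ i)) = enat m"

lemma maps_to_app:
  assumes "maps_to k i m" "k \<in> A" "x \<in> A" "c x = enat i"
  shows "c (k \<cdot> x) = enat m"
  using c_cong[of k x "lp j (2 ^ i)"] assms c_lp_pow unfolding maps_to_def by simp

section \<open>Chains of embeddings and the induction on n\<close>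

definition chain_exists :: "nat \<Rightarrow> bool" where
  "chain_exists n \<longleftrightarrow> (\<forall>m<n. \<exists>k\<in>A. c k = enat (2 ^ n - 2 ^ (m + 1)) \<and>
     maps_to k (2 ^ n - 2 ^ (m + 1)) (2 ^ n - 2 ^ m) \<and> maps_to k (2 ^ n - 2 ^ m) (2 ^ n))"

text \<open>If \<open>k\<close> moves \<open>\<gamma>\<^sub>0\<close> below \<open>\<gamma>\<^sub>K\<close>, an embedding \<open>\<kappa>\<close> of the chain turns
  \<open>k(\<gamma>\<^sub>K) = k(\<kappa>(\<gamma>\<^sub>i)) = (k \<cdot> \<kappa>)(k(\<gamma>\<^sub>i))\<close> into a bound by \<open>(k \<cdot> \<kappa>)(\<gamma>\<^sub>K)\<close>; and \<open>k \<cdot> \<kappa>\<close> is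
  larger than \<open>k\<close> in every finite quotient.\<close>

lemma chain_step:
  assumes "chain_exists n" and K: "K = 2 ^ n" and k: "k \<in> A" "c k < enat K" "c (k \<cdot> j) < enat K"
  obtains y where "y \<in> A" "c (k \<cdot> y) < enat K"
    "c ((k \<cdot> y) \<cdot> lp j (2 ^ K)) \<le> c (k \<cdot> lp j (2 ^ K))"
proof -
  \<comment> \<open>The index d m falls from K - 1 at m = 0 to 0 at m = n. As k sends \<gamma>_(K-1)
    to at least \<gamma>_K but \<gamma>_0 below it, \<open>?P\<close> changes at some m, and the
    chain element for that m is the required y.\<close>
  define d where "d m = (2::nat) ^ n - 2 ^ m" for m
  let ?P = "\<lambda>m. enat K \<le> c (k \<cdot> lp j (2 ^ d m))"
  have "?P 0"
  proof -
    have "c k \<le> enat (K - 1)" using k(2) K by (metis Suc_ile_eq Suc_pred' leD linorder_not_le pos2 zero_less_power)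
    then have "enat (Suc (K - 1)) \<le> c (k \<cdot> lp j (2 ^ d 0))"
      by (intro c_moves) (use k K in \<open>auto simp: c_lp_pow d_def\<close>)
    then show ?thesis using K by simp
  qed
  moreover have "\<not> ?P n" using k by (simp add: d_def)
  moreover have "?P m" if "\<And>m. m < n \<Longrightarrow> ?P m \<Longrightarrow> ?P (Suc m)" "m \<le> n" "?P 0" for m
    using that(2) by (induction m) (use that in auto)
  ultimately obtain m where m: "m < n" "?P m" "\<not> ?P (Suc m)" by blast
  obtain y where y: "y \<in> A" "c y = enat (d (Suc m))" "maps_to y (d m) K"
    using assms(1) m(1) K unfolding chain_exists_def d_def by auto
  have "c (k \<cdot> y) = c (k \<cdot> lp j (2 ^ d (Suc m)))"
    by (rule c_cong) (use k y c_lp_pow in auto)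
  then have "c (k \<cdot> y) < enat K" using m by simp
  moreover have "c (k \<cdot> lp j (2 ^ K)) = c (k \<cdot> (y \<cdot> lp j (2 ^ d m)))"
    by (rule c_cong) (use k y c_lp_pow app_in in \<open>auto simp: maps_to_def\<close>)
  then have "c (k \<cdot> lp j (2 ^ K)) = c ((k \<cdot> y) \<cdot> (k \<cdot> lp j (2 ^ d m)))"
    using k y by (simp add: ldist[of k y])
  moreover have "c ((k \<cdot> y) \<cdot> lp j (2 ^ K)) \<le> c ((k \<cdot> y) \<cdot> (k \<cdot> lp j (2 ^ d m)))"
    by (rule c_mono) (use k y m c_lp_pow app_in in auto)
  ultimately show ?thesis using that y by simp
qed

text \<open>If k(\<gamma>_0) is at least \<gamma>_K, the K steps from \<gamma>_0 to \<gamma>_K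
  already give the bound. Otherwise \<open>chain_step\<close> reduces to some k \<cdot> y with a
  larger residue.\<close>

lemma value_ge:
  assumes "chain_exists n" "K = 2 ^ n" "k \<in> A" "c k < enat K"
  shows "enat (2 * K) \<le> c (k \<cdot> lp j (2 ^ K))"
  using assms(3,4)
proof (induction "2 ^ K - md K k" arbitrary: k rule: less_induct)
  case less
  show ?case
  proof (cases "c (k \<cdot> j) < enat K")
    case True
    obtain y where y: "y \<in> A" "c (k \<cdot> y) < enat K"
      "c ((k \<cdot> y) \<cdot> lp j (2 ^ K)) \<le> c (k \<cdot> lp j (2 ^ K))"
      using chain_step assms less.prems True by metis
    have "md K k < 2 ^ K" "md K k < md K (k \<cdot> y)"
      using less.prems y c_less_iff_md md_app_gt by blast+
    then have "enat (2 * K) \<le> c ((k \<cdot> y) \<cdot> lp j (2 ^ K))"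
      using less.hyps less.prems y app_in by simp
    then show ?thesis using y order_trans by blast
  next
    case False
    have "c (k \<cdot> j) + enat K \<le> c (k \<cdot> lp j (2 ^ K))"
      by (rule c_shift[where i = 0]) (use less c_lp_pow[of 0] c_lp_pow[of K] j_in in auto)
    moreover have "enat K + enat K \<le> c (k \<cdot> j) + enat K" using False add_right_mono[of "enat K" "c (k \<cdot> j)" "enat K"] by (simp add: not_less)
    ultimately have "enat K + enat K \<le> c (k \<cdot> lp j (2 ^ K))" by (rule order_trans[rotated])
    then show ?thesis by (simp add: mult_2)
  qed
qed

text \<open>The reduction is that of \<open>value_ge\<close>, but when k(\<gamma>_0) reaches
  \<gamma>_K the shift gives only \<gamma>_(2K). Equality is excluded there by counting residues
  modulo 2^(2K).\<close>

lemma value_gt: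
  assumes "chain_exists n" "K = 2 ^ n" "k \<in> A" "c k < enat K" "2 ^ K < md (2 * K) k"
  shows "enat (Suc (2 * K)) \<le> c (k \<cdot> lp j (2 ^ K))"
  using assms(3,4,5)
proof (induction "2 ^ (2 * K) - md (2 * K) k" arbitrary: k rule: less_induct)
  case less
  let ?N = "2 * K" and ?M = "2 ^ K :: nat"
  have kN: "md ?N k < 2 ^ ?N" using less.prems c_less_iff_md[of k ?N]
    by (metis enat_ord_simps(2) le_add2 less_le_trans linorder_not_less mult_2 order_less_trans)
  show ?case
  proof (cases "c (k \<cdot> j) < enat K")
    case True
    obtain y where y: "y \<in> A" "c (k \<cdot> y) < enat K"
      "c ((k \<cdot> y) \<cdot> lp j (2 ^ K)) \<le> c (k \<cdot> lp j (2 ^ K))"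
      using chain_step assms less.prems True by metis
    have "md ?N k < md ?N (k \<cdot> y)" using less.prems y kN md_app_gt by blast
    then have "enat (Suc (2 * K)) \<le> c ((k \<cdot> y) \<cdot> lp j (2 ^ K))"
      using less.hyps less.prems y app_in kN by simp
    then show ?thesis using y order_trans by blast
  next
    case False
    show ?thesis
    proof (rule ccontr)
      assume "\<not> ?thesis"
      then have top: "c (k \<cdot> lp j ?M) \<le> enat ?N" by (simp add: Suc_ile_eq)
      \<comment> \<open>With M = 2^K and k(\<gamma>_K) at most \<gamma>_(2K), the residues w 1, ...,
        w (M - 1) are increasing multiples of M below M^2. This leaves room only if w 1 is at most
        M, whereas w 1 is the residue of k plus 1.\<close>
      define w where "w q = md ?N (k \<cdot> lp j q)" for q
      have w_dvd: "?M dvd w q" if "1 \<le> q" for q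
      proof -
        have "c (k \<cdot> j) \<le> c (k \<cdot> lp j q)"
          by (rule c_mono) (use less j_in c_lp_pow[of 0] in \<open>auto simp: zero_enat_def[symmetric]\<close>)
        then have "enat K \<le> c (k \<cdot> lp j q)" using False by (meson linorder_not_less order_trans)
        then show ?thesis
          using c_ge_iff_md[of "k \<cdot> lp j q" K ?N] less.prems app_in unfolding w_def by simp
      qed
      have w_lt: "w q < 2 ^ ?N" if "1 \<le> q" "q < ?M" for q
      proof -
        have "c (lp j q) < c (lp j ?M)" using c_lp_aux that c_lp_pow by simp
        then have "eSuc (c (k \<cdot> lp j q)) \<le> enat ?N"
          using c_strict[of k "lp j q" "lp j ?M"] less top by (meson lp_j_in order_trans)
        then have "c (k \<cdot> lp j q) < enat ?N" by (cases "c (k \<cdot> lp j q)") (auto simp: eSuc_enat)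
        then show ?thesis
          using c_less_iff_md[of "k \<cdot> lp j q" ?N] less.prems app_in unfolding w_def by simp
      qed
      have w_Suc: "w q < w (Suc q)" if "1 \<le> q" "q < ?M" for q
      proof -
        have "k \<cdot> lp j (Suc q) = (k \<cdot> lp j q) \<cdot> (k \<cdot> j)" using that less ldist[of k "lp j q" j] by (simp add: lp_Suc j_in)
        then show ?thesis using md_app_gt w_lt[OF that] less app_in j_in unfolding w_def by simp
      qed
      have w_add: "w 1 + q * ?M \<le> w (Suc q)" if "q < ?M" for q
        using that
      proof (induction q)
        case (Suc q)
        obtain s t where st: "w (Suc q) = ?M * s" "w (Suc (Suc q)) = ?M * t"
          using w_dvd[of "Suc q"] w_dvd[of "Suc (Suc q)"] by (auto elim!: dvdE)
        have "s < t" using w_Suc[of "Suc q"] Suc.prems st by simp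
        then have "?M * Suc s \<le> ?M * t" by (simp only: mult_le_mono2 Suc_le_eq)
        then have "w (Suc q) + ?M \<le> w (Suc (Suc q))" using st by simp
        then show ?case using Suc by simp
      qed simp
      have M2: "2 \<le> ?M" using assms(2) by (simp add: self_le_power)
      have "1 \<le> ?M - 1" using M2 by linarith
      then obtain s where s: "w (?M - 1) = ?M * s" using w_dvd by (blast elim: dvdE)
      have "?M * s < ?M * ?M" using w_lt[of "?M - 1"] s M2 by (simp add: mult_2 power_add)
      then have "s \<le> ?M - 1" by simp
      then have "w (?M - 1) \<le> ?M * (?M - 1)" using s by simp
      moreover have "w 1 + (?M - 2) * ?M \<le> w (?M - 1)"
        using w_add[of "?M - 2"] M2 by (metis Suc_1 Suc_diff_Suc Suc_le_lessD diff_less order_less_le_trans pos2 zero_less_numeral zero_less_power)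
      moreover have "?M * (?M - 1) = ?M + (?M - 2) * ?M"
        using M2 by (metis (no_types, lifting) Suc_1 Suc_diff_Suc Suc_le_lessD mult.commute mult_Suc)
      ultimately have "w 1 \<le> ?M" by linarith
      moreover have "w 1 = md ?N k + 1"
        using md_app[of k j ?N] md_lp[of 1 ?N] laver_one[OF kN] less j_in unfolding w_def by simp
      ultimately show False using less.prems by simp
    qed
  qed
qed

text \<open>The exponent shift of \<open>c_lp_aux\<close> recurs with a better bound. For q \<ge> 1
  the partial product x has residue above 2^K, so by \<open>value_gt\<close> it sends \<gamma>_K
  past \<gamma>_(2K), and agreement at \<gamma>_K becomes agreement at \<gamma>_(2K+1).\<close>

lemma lp_top_row:
  assumes "chain_exists n" "K = 2 ^ n" "1 \<le> q" "q < 2 ^ K" "r < 2 ^ K"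
  shows "eqv (enat (Suc (2 * K))) (lp j (q * 2 ^ K) \<cdot> lp j (Suc r)) (lp j (q * 2 ^ K + Suc r))"
  using assms(5)
proof (induction r)
  case 0
  then show ?case using assms by (simp add: lp_Suc eqv_refl app_in j_in)
next
  case (Suc r)
  let ?M = "2 ^ K :: nat" and ?g = "enat (Suc (2 * K))"
  let ?x = "lp j (q * ?M + Suc r)"
  have qM: "1 \<le> q * ?M" using assms by simp
  have "\<not> ?M dvd q * ?M + Suc r" using Suc.prems dvd_add_right_iff[of ?M "q * ?M" "Suc r"] dvd_imp_le[of ?M "Suc r"] by auto
  then have x: "c ?x < enat K" using c_lp_ge_iff[of "q * ?M + Suc r" K] by (simp add: linorder_not_le)
  have "q * ?M + Suc r \<le> Suc q * ?M" using Suc.prems by simp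
  also have "\<dots> \<le> ?M * ?M" using assms by (intro mult_right_mono) auto
  finally have "md (2 * K) ?x = q * ?M + Suc r" by (intro md_lp) (auto simp: mult_2 power_add)
  moreover have "?M < q * ?M + Suc r" using assms(3) by (cases q) auto
  ultimately have xv: "?g \<le> c (?x \<cdot> lp j ?M)" using value_gt[OF assms(1,2) _ x] by simp
  have "eqv (enat K) (lp j (1 + q * ?M)) (lp j 1)"
    by (rule eqv_lp_period) (simp_all add: c_lp_pow)
  then have "eqv ?g (?x \<cdot> lp j (1 + q * ?M)) (?x \<cdot> lp j 1)"
    by (rule eqv_right_add[OF _ _ c_lp_pow]) (use xv in simp_all)
  moreover have "eqv ?g ((lp j (q * ?M) \<cdot> lp j (Suc r)) \<cdot> lp j (1 + q * ?M)) (?x \<cdot> lp j (1 + q * ?M))"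
    using Suc by (simp add: eqv_left)
  moreover have "lp j (q * ?M) \<cdot> lp j (Suc (Suc r)) = (lp j (q * ?M) \<cdot> lp j (Suc r)) \<cdot> lp j (1 + q * ?M)"
    using qM ldist[of "lp j (q * ?M)" "lp j (Suc r)" j] by (simp add: lp_Suc j_in)
  moreover have "?x \<cdot> lp j 1 = lp j (q * ?M + Suc (Suc r))" by simp
  ultimately show ?case by (metis eqv_trans)
qed

text \<open>The exponent of l is odd, so its critical point is \<gamma>_0, and l \<cdot> j =
  \<open>lp j (2 ^ K)\<close> gives the first value. For the second, l \<cdot>
  \<open>lp j (2 ^ K)\<close> is the left power of \<open>lp j (2 ^ K)\<close> with exponent
  2^K.\<close>

lemma left_power_values:
  assumes "chain_exists n" "K = 2 ^ n"
  defines "l \<equiv> lp j (2 ^ K - 1)"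
  shows "c l = 0" "maps_to l 0 K" "maps_to l K (2 * K)"
proof -
  let ?M = "2 ^ K :: nat" and ?g = "enat (Suc (2 * K))"
  have K1: "1 \<le> K" using assms by simp
  have M2: "2 \<le> ?M" using K1 by (simp add: self_le_power)
  have "odd (?M - 1)" using K1 by simp
  then have "\<not> enat 1 \<le> c l" unfolding l_def using c_lp_ge_iff[of "?M - 1" 1] M2 by simp
  then show "c l = 0" by (cases "c l") (auto simp: zero_enat_def)
  have lj: "l \<cdot> j = lp j ?M" unfolding l_def using lp_Suc[of "?M - 1" j] M2 by simp
  then show "maps_to l 0 K" unfolding maps_to_def by (simp add: c_lp_pow)
  \<comment> \<open>By \<open>lp_top_row\<close> with right exponent 2^K, each further factor
    \<open>lp j (2 ^ K)\<close> raises the exponent over j by 2^K.\<close>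
  have "eqv ?g (lp (lp j ?M) (Suc q)) (lp j (Suc q * ?M))" if "q < ?M" for q
    using that
  proof (induction q)
    case (Suc q)
    have "eqv ?g (lp j (Suc q * ?M) \<cdot> lp j (Suc (?M - 1))) (lp j (Suc q * ?M + Suc (?M - 1)))"
      by (rule lp_top_row[OF assms(1,2)]) (use Suc in auto)
    then have "eqv ?g (lp j (Suc q * ?M) \<cdot> lp j ?M) (lp j (Suc (Suc q) * ?M))"
      by (simp add: algebra_simps)
    moreover have "eqv ?g (lp (lp j ?M) (Suc (Suc q))) (lp j (Suc q * ?M) \<cdot> lp j ?M)"
      using Suc by (simp add: eqv_left)
    ultimately show ?case using eqv_trans by blast
  qed (simp add: eqv_refl)
  from this[of "?M - 1"] have "eqv ?g (lp (lp j ?M) ?M) (lp j (?M * ?M))" by simp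
  moreover have "?M * ?M = 2 ^ (2 * K)" by (simp add: mult_2 power_add)
  moreover have "lp (lp j ?M) ?M = l \<cdot> lp j ?M"
    using app_lp[of l j ?M] lj j_in by (simp add: l_def)
  ultimately have "eqv ?g (l \<cdot> lp j ?M) (lp j (2 ^ (2 * K)))" by simp
  \<comment> \<open>Equivalence at \<gamma>_(2K+1), one step above the value \<gamma>_(2K), is what
    yields equality and not just a lower bound.\<close>
  from eqv_min_c[OF this] show "maps_to l K (2 * K)"
    unfolding maps_to_def c_lp_pow by (auto simp: min_def split: if_splits)
qed

text \<open>The embedding l itself covers m = n, with indices 0, K, 2K. For m < n the identity (l
  \<cdot> k)(l(\<gamma>_i)) = l(k(\<gamma>_i)) transports the old chain element upwards by
  K.\<close>

lemma chain_exists_Suc: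
  assumes "chain_exists n"
  shows "chain_exists (Suc n)"
  unfolding chain_exists_def
proof (intro allI impI)
  fix m assume m: "m < Suc n"
  define K where "K = (2::nat) ^ n"
  define l where "l = lp j (2 ^ K - 1)"
  note l = left_power_values[OF assms K_def, folded l_def]
  have lA: "l \<in> A" by (simp add: l_def)
  \<comment> \<open>The values at \<gamma>_0 and \<gamma>_K are exactly K steps apart, so
    \<open>c_shift\<close> from both ends leaves no freedom in between.\<close>
  have l_shift: "maps_to l i (K + i)" if "i \<le> K" for i
  proof -
    let ?v = "c (l \<cdot> lp j (2 ^ i))"
    have "enat K + enat i \<le> ?v"
      using c_shift[of l "lp j (2 ^ 0)" "lp j (2 ^ i)" 0 i] lA l(2) c_lp_pow[of 0] j_in by (simp add: maps_to_def c_lp_pow)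
    moreover have "?v + enat (K - i) \<le> enat (2 * K)"
      using c_shift[of l "lp j (2 ^ i)" "lp j (2 ^ K)" i "K - i"] lA l(3) that
      by (simp add: maps_to_def c_lp_pow)
    ultimately show ?thesis unfolding maps_to_def using that by (cases ?v) auto
  qed
  show "\<exists>k\<in>A. c k = enat (2 ^ Suc n - 2 ^ (m + 1)) \<and>
      maps_to k (2 ^ Suc n - 2 ^ (m + 1)) (2 ^ Suc n - 2 ^ m) \<and>
      maps_to k (2 ^ Suc n - 2 ^ m) (2 ^ Suc n)"
  proof (cases "m = n")
    case True
    then show ?thesis using l lA by (intro bexI[of _ l]) (auto simp: K_def zero_enat_def)
  next
    case False
    then have "m < n" using m by simp
    then obtain k where k: "k \<in> A" "c k = enat (K - 2 ^ (m + 1))"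
      "maps_to k (K - 2 ^ (m + 1)) (K - 2 ^ m)" "maps_to k (K - 2 ^ m) K"
      using assms unfolding chain_exists_def K_def by blast
    have le: "2 ^ (m + 1) \<le> K" "2 ^ m \<le> K"
      using \<open>m < n\<close> unfolding K_def by (auto intro!: power_increasing simp del: power_Suc)
    have lift: "maps_to (l \<cdot> k) (K + i) (K + i')" if "maps_to k i i'" "i \<le> K" "i' \<le> K" for i i'
    proof -
      have "c ((l \<cdot> k) \<cdot> lp j (2 ^ (K + i))) = c ((l \<cdot> k) \<cdot> (l \<cdot> lp j (2 ^ i)))"
        by (rule c_cong) (use lA k l_shift[OF that(2)] in \<open>auto simp: app_in c_lp_pow maps_to_def\<close>)
      also have "\<dots> = c (l \<cdot> (k \<cdot> lp j (2 ^ i)))" using lA k by (simp add: ldist[of l k])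
      also have "\<dots> = enat (K + i')"
        by (rule maps_to_app[OF l_shift[OF that(3)]]) (use lA k that in \<open>auto simp: app_in maps_to_def\<close>)
      finally show ?thesis unfolding maps_to_def .
    qed
    have "c (l \<cdot> k) = enat (K + (K - 2 ^ (m + 1)))"
      by (rule maps_to_app[OF l_shift]) (use lA k in auto)
    moreover have "2 ^ Suc n - 2 ^ (m + 1) = K + (K - 2 ^ (m + 1))" "2 ^ Suc n - 2 ^ m = K + (K - 2 ^ m)"
      "2 ^ Suc n = K + K"
      using le by (auto simp: K_def)
    ultimately show ?thesis
      using lift[OF k(3)] lift[OF k(4)] lA k app_in by (intro bexI[of _ "l \<cdot> k"]) auto
  qed
qed

lemma chain_exists: "chain_exists n"
  by (induction n) (auto simp: chain_exists_Suc, simp add: chain_exists_def)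

end

section \<open>Sets, ordinals and ranks\<close>

definition small :: "'v::zfc_universe set \<Rightarrow> bool" where
  "small X \<longleftrightarrow> (\<exists>x. elts x = X)"

lemma small_elts [simp]: "small (elts x)"
  by (auto simp: small_def)

lemma elts_eq_iff: "elts x = elts y \<longleftrightarrow> x = y"
  using extensionality by blast

lemma elts_vset: "small X \<Longrightarrow> elts (vset X) = X"
  unfolding small_def vset_def by (metis (mono_tags, lifting) elts_eq_iff the_equality)

lemma vset_elts [simp]: "vset (elts x) = x"
  using elts_vset[of "elts x"] by (simp add: elts_eq_iff)

lemma small_subset: "small Y \<Longrightarrow> X \<subseteq> Y \<Longrightarrow> small X"
  unfolding small_def using separation by blast

lemma small_image: "small X \<Longrightarrow> small (f ` X)" for f :: "'v::zfc_universe \<Rightarrow> 'v"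
proof -
  assume "small X"
  then obtain x where x: "elts x = X" unfolding small_def ..
  show ?thesis using replacement[of f x] unfolding small_def x .
qed

lemma small_pair [simp]: "small {x, y}"
  unfolding small_def by (rule pairing)

lemma small_singleton [simp]: "small {x}"
  using small_pair[of x x] by simp

lemma small_Union_elts: "small X \<Longrightarrow> small (\<Union>y\<in>X. elts y)"
proof -
  assume "small X"
  then obtain x where x: "elts x = X" unfolding small_def ..
  show ?thesis using union[of x] unfolding small_def x .
qed

lemma small_UN:
  fixes f :: "'v::zfc_universe \<Rightarrow> 'v set"
  assumes "small X" "\<And>x. x \<in> X \<Longrightarrow> small (f x)"
  shows "small (\<Union>x\<in>X. f x)"
proof -
  have "(\<Union>x\<in>X. f x) = (\<Union>y\<in>(\<lambda>x. vset (f x)) ` X. elts y)"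
    using assms(2) by (simp add: elts_vset)
  then show ?thesis using small_Union_elts[OF small_image[OF assms(1), of "\<lambda>x. vset (f x)"]] by (simp only:)
qed

lemma small_Un: "small X \<Longrightarrow> small Y \<Longrightarrow> small (X \<union> Y)"
  using small_UN[of "{vset X, vset Y}" elts] by (simp add: elts_vset)

lemma small_insert: "small X \<Longrightarrow> small (insert a X)"
  using small_Un[of "{a}" X] by simp

lemma small_Pow: "small X \<Longrightarrow> small {y. elts y \<subseteq> X}"
  unfolding small_def using power_set by blast

lemma elts_induct [case_names step]:
  assumes "\<And>x. (\<And>y. y \<in> elts x \<Longrightarrow> P y) \<Longrightarrow> P x"
  shows "P (x::'v::zfc_universe)"
  by (rule wf_induct_rule[OF foundation]) (use assms in auto)

lemma mem_not_refl: "x \<notin> elts (x::'v::zfc_universe)"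
  using foundation by (auto dest: wf_not_refl)

lemma mem_not_sym: "x \<in> elts y \<Longrightarrow> y \<notin> elts (x::'v::zfc_universe)"
  using foundation by (auto dest: wf_not_sym)

lemma vset_eq_iff: "small X \<Longrightarrow> small Y \<Longrightarrow> vset X = vset Y \<longleftrightarrow> X = Y"
  by (metis elts_vset)

lemma kpair_eq [simp]: "kpair x y = kpair x' y' \<longleftrightarrow> x = x' \<and> y = y'"
  unfolding kpair_def by (auto simp: vset_eq_iff doubleton_eq_iff)

lemma elts_kpair: "elts (kpair x y) = {vset {x}, vset {x, y}}"
  unfolding kpair_def by (simp add: elts_vset)

section \<open>Ordinals\<close>

lemma ordinal_mem: "ordinal x \<Longrightarrow> y \<in> elts x \<Longrightarrow> ordinal y"
  unfolding ordinal_def transitive_def by blast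

lemma ordinal_trans: "ordinal x \<Longrightarrow> y \<in> elts x \<Longrightarrow> z \<in> elts y \<Longrightarrow> z \<in> elts x"
  unfolding ordinal_def transitive_def by blast

lemma ordinal_linear: "ordinal x \<Longrightarrow> ordinal y \<Longrightarrow> x \<in> elts y \<or> x = y \<or> y \<in> elts x"
proof (induction x arbitrary: y rule: elts_induct)
  case (step x)
  note IH = step.IH
  show ?case using step.prems(2)
  proof (induction y rule: elts_induct)
    case (step y)
    show ?case
    proof (rule ccontr)
      assume neg: "\<not> ?thesis"
      have "elts x \<subseteq> elts y"
      proof
        fix z assume "z \<in> elts x"
        then have "z \<in> elts y \<or> z = y \<or> y \<in> elts z"
          using IH[of z y] step.prems \<open>ordinal x\<close> ordinal_mem by blast
        then show "z \<in> elts y" using neg \<open>z \<in> elts x\<close> \<open>ordinal x\<close> ordinal_trans by blast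
      qed
      moreover have "elts y \<subseteq> elts x"
      proof
        fix z assume "z \<in> elts y"
        then have "x \<in> elts z \<or> x = z \<or> z \<in> elts x"
          using step.IH[of z] step.prems ordinal_mem by blast
        then show "z \<in> elts x" using neg \<open>z \<in> elts y\<close> step.prems ordinal_trans by blast
      qed
      ultimately show False using neg elts_eq_iff by blast
    qed
  qed
qed

lemma ordinal_subset_iff:
  "ordinal x \<Longrightarrow> ordinal y \<Longrightarrow> elts x \<subseteq> elts y \<longleftrightarrow> x \<in> elts y \<or> x = y"
  using ordinal_linear ordinal_trans mem_not_refl by blast

section \<open>Ranks and the cumulative hierarchy\<close>

lemma small_rank: "small (\<Union>y\<in>elts x. insert (rank y) (elts (rank y)))"
  by (intro small_UN small_insert) simp_all

lemma elts_rank: "elts (rank x) = (\<Union>y\<in>elts x. insert (rank y) (elts (rank y)))"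
  by (subst rank.simps) (rule elts_vset[OF small_rank])

lemma ordinal_rank [simp]: "ordinal (rank x)"
proof (induction x rule: elts_induct)
  case (step x)
  have "transitive (rank x)"
    unfolding transitive_def using step by (auto simp: elts_rank[of x] dest: ordinal_trans)
  moreover have "transitive y" if "y \<in> elts (rank x)" for y
    using that step by (auto simp: elts_rank[of x] ordinal_def)
  ultimately show ?case unfolding ordinal_def by blast
qed

lemma rank_ordinal: "ordinal x \<Longrightarrow> rank x = x"
proof (induction x rule: elts_induct)
  case (step x)
  have "elts (rank x) = (\<Union>y\<in>elts x. insert y (elts y))"
    using step ordinal_mem by (subst elts_rank) auto
  also have "\<dots> = elts x" using step.prems ordinal_trans by blast
  finally show ?case by (simp add: elts_eq_iff)
qed

lemma rank_mem: "y \<in> elts x \<Longrightarrow> rank y \<in> elts (rank x)"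
  by (auto simp: elts_rank[of x])

lemma rank_subset_iff:
  assumes "ordinal \<alpha>"
  shows "elts (rank x) \<subseteq> elts \<alpha> \<longleftrightarrow> (\<forall>y\<in>elts x. rank y \<in> elts \<alpha>)"
proof
  show "\<forall>y\<in>elts x. rank y \<in> elts \<alpha>" if "elts (rank x) \<subseteq> elts \<alpha>"
    using that rank_mem by blast
  show "elts (rank x) \<subseteq> elts \<alpha>" if *: "\<forall>y\<in>elts x. rank y \<in> elts \<alpha>"
  proof
    fix z assume "z \<in> elts (rank x)"
    then obtain y where "y \<in> elts x" "z = rank y \<or> z \<in> elts (rank y)"
      by (subst (asm) elts_rank) blast
    then show "z \<in> elts \<alpha>" using * ordinal_trans[OF assms] by blast
  qed
qed

lemma mem_Vlevel: "x \<in> Vlevel \<alpha> \<longleftrightarrow> rank x \<in> elts \<alpha>"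
  by (simp add: Vlevel_def ord_less_def)

lemma subset_Vlevel_iff:
  "ordinal \<alpha> \<Longrightarrow> elts x \<subseteq> Vlevel \<alpha> \<longleftrightarrow> rank x \<in> elts \<alpha> \<or> rank x = \<alpha>"
  using rank_subset_iff[of \<alpha> x] ordinal_subset_iff[of "rank x" \<alpha>] by (auto simp: mem_Vlevel)

lemma Vlevel_trans: "ordinal \<alpha> \<Longrightarrow> x \<in> Vlevel \<alpha> \<Longrightarrow> elts x \<subseteq> Vlevel \<alpha>"
  by (simp add: subset_Vlevel_iff mem_Vlevel)

lemma Vlevel_downward:
  assumes "ordinal \<alpha>" "x \<in> Vlevel \<alpha>" "elts y \<subseteq> elts x"
  shows "y \<in> Vlevel \<alpha>"
proof -
  have "elts (rank y) \<subseteq> elts (rank x)"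
    using assms(3) rank_mem rank_subset_iff[of "rank x" y] by auto
  then have "rank y \<in> elts (rank x) \<or> rank y = rank x" by (simp add: ordinal_subset_iff)
  then show ?thesis using assms ordinal_trans by (auto simp: mem_Vlevel)
qed

lemma Vlevel_mono: "ordinal \<beta> \<Longrightarrow> \<alpha> \<in> elts \<beta> \<or> \<alpha> = \<beta> \<Longrightarrow> Vlevel \<alpha> \<subseteq> Vlevel \<beta>"
  using ordinal_trans by (auto simp: mem_Vlevel)

lemma ordinal_mem_Vlevel: "ordinal \<beta> \<Longrightarrow> \<beta> \<in> Vlevel \<alpha> \<longleftrightarrow> \<beta> \<in> elts \<alpha>"
  by (simp add: mem_Vlevel rank_ordinal)

lemma Vlevel_eq_UN: "ordinal \<alpha> \<Longrightarrow> Vlevel \<alpha> = (\<Union>\<beta>\<in>elts \<alpha>. {x. elts x \<subseteq> Vlevel \<beta>})"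
proof (intro set_eqI iffI)
  fix x assume "ordinal \<alpha>" "x \<in> Vlevel \<alpha>"
  then show "x \<in> (\<Union>\<beta>\<in>elts \<alpha>. {x. elts x \<subseteq> Vlevel \<beta>})"
    using subset_Vlevel_iff[of "rank x" x] by (auto simp: mem_Vlevel)
next
  fix x assume "ordinal \<alpha>" "x \<in> (\<Union>\<beta>\<in>elts \<alpha>. {x. elts x \<subseteq> Vlevel \<beta>})"
  then obtain \<beta> where "\<beta> \<in> elts \<alpha>" "elts x \<subseteq> Vlevel \<beta>" by blast
  then show "x \<in> Vlevel \<alpha>"
    using subset_Vlevel_iff[of \<beta> x] \<open>ordinal \<alpha>\<close> ordinal_mem ordinal_trans
    unfolding mem_Vlevel by blast
qed

lemma small_Vlevel: "ordinal \<alpha> \<Longrightarrow> small (Vlevel \<alpha>)"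
proof (induction \<alpha> rule: elts_induct)
  case (step \<alpha>)
  then show ?case using ordinal_mem by (subst Vlevel_eq_UN) (auto intro!: small_UN small_Pow)
qed

definition Vset :: "'v \<Rightarrow> 'v::zfc_universe" where
  "Vset \<alpha> = vset (Vlevel \<alpha>)"

lemma elts_Vset: "ordinal \<alpha> \<Longrightarrow> elts (Vset \<alpha>) = Vlevel \<alpha>"
  by (simp add: Vset_def elts_vset small_Vlevel)

lemma rank_Vset: "ordinal \<alpha> \<Longrightarrow> rank (Vset \<alpha>) = \<alpha>"
proof -
  assume \<alpha>: "ordinal \<alpha>"
  have "rank (Vset \<alpha>) \<notin> elts \<alpha>"
    using elts_Vset[OF \<alpha>] mem_Vlevel mem_not_refl by blast
  then show ?thesis using subset_Vlevel_iff[OF \<alpha>, of "Vset \<alpha>"] elts_Vset[OF \<alpha>] by blast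
qed

text \<open>The rank of a set of ordinals is its least strict upper bound.\<close>

lemma union_of_ordinals:
  assumes "small X" "\<And>x. x \<in> X \<Longrightarrow> ordinal x"
  obtains \<delta> where "ordinal \<delta>" "elts \<delta> = (\<Union>\<beta>\<in>X. insert \<beta> (elts \<beta>))"
proof
  have e: "elts (rank (vset X)) = (\<Union>\<beta>\<in>X. insert \<beta> (elts \<beta>))"
    using assms by (subst elts_rank) (simp add: elts_vset rank_ordinal)
  then show "elts (rank (vset X)) = (\<Union>\<beta>\<in>X. insert \<beta> (elts \<beta>))" .
qed simp

lemma Un_Pow_Vlevel:
  assumes "small X" "\<And>x. x \<in> X \<Longrightarrow> ordinal x"
  obtains \<delta> where "ordinal \<delta>" "Vlevel \<delta> = (\<Union>\<beta>\<in>X. {x. elts x \<subseteq> Vlevel \<beta>})"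
proof -
  obtain \<delta> where \<delta>: "ordinal \<delta>" "elts \<delta> = (\<Union>\<beta>\<in>X. insert \<beta> (elts \<beta>))"
    using union_of_ordinals[OF assms] by blast
  have "Vlevel \<delta> = (\<Union>\<beta>\<in>X. {x. elts x \<subseteq> Vlevel \<beta>})"
  proof -
    have "(\<Union>\<beta>\<in>X. {x. elts x \<subseteq> Vlevel \<beta>}) = (\<Union>\<beta>\<in>X. {x. rank x \<in> elts \<beta> \<or> rank x = \<beta>})"
      by (rule SUP_cong) (use assms(2) subset_Vlevel_iff in auto)
    then show ?thesis using \<delta>(2) by (auto simp: mem_Vlevel)
  qed
  then show ?thesis using that \<delta>(1) by blast
qed

lemma rank_pair: "rank (vset {x, y}) \<in> elts \<alpha> \<longleftrightarrow>
   (\<exists>\<beta>\<in>elts \<alpha>. rank x \<in> elts \<beta> \<and> rank y \<in> elts \<beta>)" if "ordinal \<alpha>"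
proof
  assume "rank (vset {x, y}) \<in> elts \<alpha>"
  then show "\<exists>\<beta>\<in>elts \<alpha>. rank x \<in> elts \<beta> \<and> rank y \<in> elts \<beta>"
    by (intro bexI[of _ "rank (vset {x, y})"]) (auto intro!: rank_mem simp: elts_vset)
next
  assume "\<exists>\<beta>\<in>elts \<alpha>. rank x \<in> elts \<beta> \<and> rank y \<in> elts \<beta>"
  then obtain \<beta> where \<beta>: "\<beta> \<in> elts \<alpha>" "rank x \<in> elts \<beta>" "rank y \<in> elts \<beta>" by blast
  then have "rank (vset {x, y}) \<in> elts \<beta> \<or> rank (vset {x, y}) = \<beta>"
    using subset_Vlevel_iff[of \<beta> "vset {x, y}"] that ordinal_mem by (auto simp: elts_vset mem_Vlevel)
  then show "rank (vset {x, y}) \<in> elts \<alpha>" using \<beta> that ordinal_trans by blast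
qed

section \<open>Closure properties of a limit stage of the hierarchy\<close>

locale limit_stage =
  fixes \<Lambda> :: "'v::zfc_universe"
  assumes limit: "limit_ordinal \<Lambda>"
begin

abbreviation "V \<equiv> Vlevel \<Lambda>"

lemma ord_L: "ordinal \<Lambda>"
  using limit by (simp add: limit_ordinal_def)

lemma L_succ: "\<alpha> \<in> elts \<Lambda> \<Longrightarrow> \<exists>\<beta>\<in>elts \<Lambda>. \<alpha> \<in> elts \<beta>"
  using limit by (simp add: limit_ordinal_def)

lemma ord: "\<alpha> \<in> elts \<Lambda> \<Longrightarrow> ordinal \<alpha>"
  using ord_L ordinal_mem by blast

lemma elts_Vset_L: "\<alpha> \<in> elts \<Lambda> \<Longrightarrow> elts (Vset \<alpha>) = Vlevel \<alpha>"
  by (simp add: elts_Vset ord)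

lemma L_upper2: "\<alpha> \<in> elts \<Lambda> \<Longrightarrow> \<beta> \<in> elts \<Lambda> \<Longrightarrow> \<exists>\<gamma>\<in>elts \<Lambda>. \<alpha> \<in> elts \<gamma> \<and> \<beta> \<in> elts \<gamma>"
  by (metis L_succ ord ordinal_linear ordinal_trans)

lemma V_mem: "x \<in> V \<Longrightarrow> y \<in> elts x \<Longrightarrow> y \<in> V"
  using Vlevel_trans ord_L by blast

lemma V_pair: "x \<in> V \<Longrightarrow> y \<in> V \<Longrightarrow> vset {x, y} \<in> V"
  using L_upper2 by (simp add: mem_Vlevel rank_pair[OF ord_L])

lemma V_kpair: "x \<in> V \<Longrightarrow> y \<in> V \<Longrightarrow> kpair x y \<in> V"
  unfolding kpair_def using V_pair[of x x] V_pair by simp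

lemma V_level: "x \<in> V \<Longrightarrow> \<exists>\<alpha>\<in>elts \<Lambda>. x \<in> Vlevel \<alpha>"
  using L_succ by (auto simp: mem_Vlevel)

lemma V_subset_level: "\<alpha> \<in> elts \<Lambda> \<Longrightarrow> elts x \<subseteq> Vlevel \<alpha> \<Longrightarrow> x \<in> V"
  using subset_Vlevel_iff[OF ord] ord_L ordinal_trans by (auto simp: mem_Vlevel)

lemma Vset_in_V: "\<alpha> \<in> elts \<Lambda> \<Longrightarrow> Vset \<alpha> \<in> V"
  by (simp add: mem_Vlevel rank_Vset ord)

lemma level_subset_V: "\<alpha> \<in> elts \<Lambda> \<Longrightarrow> Vlevel \<alpha> \<subseteq> V"
  using Vlevel_mono ord_L by blast

lemma ordinals_in_V: "\<alpha> \<in> elts \<Lambda> \<Longrightarrow> \<alpha> \<in> V"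
  using ordinal_mem_Vlevel ord by blast

lemma level_kpair:
  assumes "\<alpha> \<in> elts \<Lambda>"
  shows "\<exists>\<beta>\<in>elts \<Lambda>. \<forall>x\<in>Vlevel \<alpha>. \<forall>y\<in>Vlevel \<alpha>. kpair x y \<in> Vlevel \<beta>"
proof -
  obtain \<beta> where \<beta>: "\<beta> \<in> elts \<Lambda>" "\<alpha> \<in> elts \<beta>" using L_succ assms by blast
  obtain \<gamma> where \<gamma>: "\<gamma> \<in> elts \<Lambda>" "\<beta> \<in> elts \<gamma>" using L_succ \<beta> by blast
  have "vset {x, y} \<in> Vlevel \<beta>" if "x \<in> Vlevel \<alpha>" "y \<in> Vlevel \<alpha>" for x y
    using that \<beta> rank_pair[OF ord[OF \<beta>(1)]] by (auto simp: mem_Vlevel)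
  moreover have "vset {x, y} \<in> Vlevel \<gamma>" if "x \<in> Vlevel \<beta>" "y \<in> Vlevel \<beta>" for x y
    using that \<gamma> rank_pair[OF ord[OF \<gamma>(1)]] by (auto simp: mem_Vlevel)
  ultimately have "kpair x y \<in> Vlevel \<gamma>" if "x \<in> Vlevel \<alpha>" "y \<in> Vlevel \<alpha>" for x y
    unfolding kpair_def using that by (metis insert_absorb2)
  then show ?thesis using \<gamma> by blast
qed

end

section \<open>Embeddings preserving bounded formulas\<close>

text \<open>Pairs and levels are atoms so that restrictions of embeddings to levels can be described
  with bounded quantifiers only. The type of variables is a parameter, from which the datatype
  obtains renaming (\<open>map_bfm\<close>) and the set of variables
  (\<open>set_bfm\<close>).\<close>

datatype 'i bfm = BMem 'i 'i | BEq 'i 'i | BPair 'i 'i 'i | BLev 'i 'i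
  | BNeg "'i bfm" | BConj "'i bfm" "'i bfm" | BBall 'i 'i "'i bfm"

text \<open>A quantifier bounded by its own variable counts as true. This matches the first-order
  reading, whose bound x \<in> x is never satisfied.\<close>

primrec bsat :: "('i \<Rightarrow> 'v::zfc_universe) \<Rightarrow> 'i bfm \<Rightarrow> bool" where
  "bsat e (BMem i k) \<longleftrightarrow> e i \<in> elts (e k)"
| "bsat e (BEq i k) \<longleftrightarrow> e i = e k"
| "bsat e (BPair i k l) \<longleftrightarrow> e i = kpair (e k) (e l)"
| "bsat e (BLev i k) \<longleftrightarrow> ordinal (e k) \<and> elts (e i) = Vlevel (e k)"
| "bsat e (BNeg \<phi>) \<longleftrightarrow> \<not> bsat e \<phi>"
| "bsat e (BConj \<phi> \<psi>) \<longleftrightarrow> bsat e \<phi> \<and> bsat e \<psi>"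
| "bsat e (BBall i k \<phi>) \<longleftrightarrow> (i \<noteq> k \<longrightarrow> (\<forall>x\<in>elts (e k). bsat (e(i := x)) \<phi>))"

definition "BImp \<phi> \<psi> = BNeg (BConj \<phi> (BNeg \<psi>))"
definition "BIff \<phi> \<psi> = BConj (BImp \<phi> \<psi>) (BImp \<psi> \<phi>)"
definition "BEx i k \<phi> = BNeg (BBall i k (BNeg \<phi>))"

lemma bsat_simps [simp]:
  "bsat e (BImp \<phi> \<psi>) \<longleftrightarrow> (bsat e \<phi> \<longrightarrow> bsat e \<psi>)"
  "bsat e (BIff \<phi> \<psi>) \<longleftrightarrow> (bsat e \<phi> \<longleftrightarrow> bsat e \<psi>)"
  "i \<noteq> k \<Longrightarrow> bsat e (BEx i k \<phi>) \<longleftrightarrow> (\<exists>x\<in>elts (e k). bsat (e(i := x)) \<phi>)"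
  by (auto simp: BImp_def BIff_def BEx_def)

lemma bsat_map: "inj \<rho> \<Longrightarrow> bsat e (map_bfm \<rho> \<phi>) \<longleftrightarrow> bsat (e \<circ> \<rho>) \<phi>"
proof (induction \<phi> arbitrary: e)
  case (BBall i k \<phi>)
  have "e(\<rho> i := x) \<circ> \<rho> = (e \<circ> \<rho>)(i := x)" for x
    using BBall.prems by (auto simp: fun_eq_iff inj_def)
  then have "bsat (e(\<rho> i := x)) (map_bfm \<rho> \<phi>) \<longleftrightarrow> bsat ((e \<circ> \<rho>)(i := x)) \<phi>" for x
    using BBall.IH[OF BBall.prems, of "e(\<rho> i := x)"] by (simp only:)
  then show ?case using BBall.prems by (simp add: inj_eq comp_def)
qed auto

lemma bsat_cong: "(\<And>i. i \<in> set_bfm \<phi> \<Longrightarrow> e i = e' i) \<Longrightarrow> bsat e \<phi> \<longleftrightarrow> bsat e' \<phi>"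
proof (induction \<phi> arbitrary: e e')
  case (BBall i k \<phi>)
  have "bsat (e(i := x)) \<phi> \<longleftrightarrow> bsat (e'(i := x)) \<phi>" for x
    by (rule BBall.IH) (use BBall.prems in auto)
  then show ?case using BBall.prems by simp
next
  case (BNeg \<phi>)
  have "bsat e \<phi> \<longleftrightarrow> bsat e' \<phi>" by (rule BNeg.IH) (use BNeg.prems in auto)
  then show ?case by simp
next
  case (BConj \<phi> \<psi>)
  have "bsat e \<phi> \<longleftrightarrow> bsat e' \<phi>" "bsat e \<psi> \<longleftrightarrow> bsat e' \<psi>"
    by (rule BConj.IH; use BConj.prems in auto)+
  then show ?case by simp
qed simp_all

lemma finite_set_bfm: "finite (set_bfm \<phi>)"
  by (induction \<phi>) auto

text \<open>Variables 0, 1, 2 stand for function, domain and codomain. Uniqueness of values is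
  asserted only inside the codomain, to keep its quantifiers bounded; the second conjunct puts every
  value there.\<close>

definition bfunction :: "nat bfm" where
  "bfunction = BConj (BBall 3 1 (BEx 4 2 (BEx 5 0 (BPair 5 3 4))))
     (BConj (BBall 5 0 (BEx 3 1 (BEx 4 2 (BPair 5 3 4))))
       (BBall 3 1 (BBall 4 2 (BBall 6 2 (BImp (BEx 5 0 (BPair 5 3 4))
          (BImp (BEx 5 0 (BPair 5 3 6)) (BEq 4 6)))))))"

lemma bsat_bfunction: "bsat e bfunction \<longleftrightarrow> is_function (e 0) (elts (e 1)) (elts (e 2))"
proof -
  have "bsat e bfunction \<longleftrightarrow>
      (\<forall>x\<in>elts (e 1). \<exists>y\<in>elts (e 2). kpair x y \<in> elts (e 0)) \<and>
      (\<forall>p\<in>elts (e 0). \<exists>x\<in>elts (e 1). \<exists>y\<in>elts (e 2). p = kpair x y) \<and>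
      (\<forall>x\<in>elts (e 1). \<forall>y\<in>elts (e 2). \<forall>z\<in>elts (e 2).
          kpair x y \<in> elts (e 0) \<longrightarrow> kpair x z \<in> elts (e 0) \<longrightarrow> y = z)"
    by (simp add: bfunction_def)
  also have "\<dots> \<longleftrightarrow> is_function (e 0) (elts (e 1)) (elts (e 2))" (is "?l \<longleftrightarrow> ?r")
  proof
    assume l: ?l
    then have sub: "y \<in> elts (e 2)" if "kpair x y \<in> elts (e 0)" for x y
      using that by fastforce
    from l have "elts (e 0) \<subseteq> {kpair x y |x y. x \<in> elts (e 1) \<and> y \<in> elts (e 2)}" by blast
    moreover have "\<exists>!y. kpair x y \<in> elts (e 0)" if "x \<in> elts (e 1)" for x
      using l sub that by meson
    ultimately show ?r unfolding is_function_def by blast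
  next
    assume r: ?r
    then have sub: "y \<in> elts (e 2)" if "kpair x y \<in> elts (e 0)" for x y
      using that unfolding is_function_def by fastforce
    show ?l
    proof (intro conjI)
      show "\<forall>x\<in>elts (e 1). \<exists>y\<in>elts (e 2). kpair x y \<in> elts (e 0)"
        using r sub unfolding is_function_def by blast
    qed (use r in \<open>unfold is_function_def, blast+\<close>)
  qed
  finally show ?thesis .
qed

lemma is_function_mem_iff:
  assumes "is_function g A B"
  shows "kpair x y \<in> elts g \<longleftrightarrow> x \<in> A \<and> y = val g x"
proof -
  have *: "kpair x (val g x) \<in> elts g" if "x \<in> A"
    unfolding val_def by (rule theI') (use assms that in \<open>auto simp: is_function_def\<close>)
  have "x \<in> A" if "kpair x y \<in> elts g"
    using assms that unfolding is_function_def by fastforce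
  then show ?thesis using assms * unfolding is_function_def by blast
qed

lemma is_function_val: "is_function g A B \<Longrightarrow> x \<in> A \<Longrightarrow> val g x \<in> B"
  using is_function_mem_iff[of g A B x "val g x"] unfolding is_function_def by fastforce

lemma is_function_elts: "is_function g A B \<Longrightarrow> elts g = {kpair x (val g x) | x. x \<in> A}"
  using is_function_mem_iff[of g A B] unfolding is_function_def by blast

lemma is_functionI:
  assumes "elts g = {kpair x (f x) | x. x \<in> A}" "\<And>x. x \<in> A \<Longrightarrow> f x \<in> B"
  shows "is_function g A B" "\<And>x. x \<in> A \<Longrightarrow> val g x = f x"
proof -
  show "is_function g A B" unfolding is_function_def using assms by auto
  then show "val g x = f x" if "x \<in> A" for x
    using that is_function_mem_iff[of g A B x "f x"] assms by auto
qed

lemma elts_restr: "elts (restr f A) = {p \<in> elts f. \<exists>x\<in>A. \<exists>y. p = kpair x y}"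
  unfolding restr_def by (rule elts_vset[OF small_subset[OF small_elts[of f]]]) auto

lemma restr_function:
  assumes "is_function f A B" "X \<subseteq> A"
  shows "elts (restr f X) = {kpair x (val f x) | x. x \<in> X}"
  unfolding elts_restr is_function_elts[OF assms(1)] using assms(2) by auto

text \<open>The formula says that the function 0 from 1 to 2 preserves \<open>\<phi>\<close>, an assertion about sets which
  an embedding carries over. The variables of \<open>\<phi>\<close> are duplicated into even ones for the arguments
  and odd ones for the values.\<close>

primrec btransfer :: "nat bfm \<Rightarrow> nat \<Rightarrow> nat bfm" where
  "btransfer \<phi> 0 = BIff (map_bfm (\<lambda>i. 2 * i + 4) \<phi>) (map_bfm (\<lambda>i. 2 * i + 5) \<phi>)"
| "btransfer \<phi> (Suc n) = BBall (2 * n + 4) 1 (BBall (2 * n + 5) 2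
     (BImp (BEx 3 0 (BPair 3 (2 * n + 4) (2 * n + 5))) (btransfer \<phi> n)))"

text \<open>Variables of index n or more keep the values of the surrounding environment. Once n
  exceeds all variables of \<phi>, the formula expresses full preservation of \<phi>.\<close>

lemma bsat_btransfer:
  "bsat e (btransfer \<phi> n) \<longleftrightarrow>
     (\<forall>x y. (\<forall>i<n. x i \<in> elts (e 1) \<and> y i \<in> elts (e 2) \<and> kpair (x i) (y i) \<in> elts (e 0)) \<longrightarrow>
        (bsat (\<lambda>i. if i < n then x i else e (2 * i + 4)) \<phi> \<longleftrightarrow>
         bsat (\<lambda>i. if i < n then y i else e (2 * i + 5)) \<phi>))"
proof (induction n arbitrary: e)
  case 0
  have "inj (\<lambda>i::nat. 2 * i + 4)" "inj (\<lambda>i::nat. 2 * i + 5)" by (auto simp: inj_def)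
  then show ?case by (simp add: bsat_map comp_def)
next
  case (Suc n)
  let ?e = "\<lambda>u v. e(2 * n + 4 := u, 2 * n + 5 := v)"
  have step: "bsat e (btransfer \<phi> (Suc n)) \<longleftrightarrow>
      (\<forall>u\<in>elts (e 1). \<forall>v\<in>elts (e 2). kpair u v \<in> elts (e 0) \<longrightarrow> bsat (?e u v) (btransfer \<phi> n))"
    by (auto simp: numeral_eq_Suc)
  have env: "(\<lambda>i. if i < n then x i else ?e (x n) (y n) (2 * i + 4)) =
      (\<lambda>i. if i < Suc n then x i else e (2 * i + 4))"
    "(\<lambda>i. if i < n then y i else ?e (x n) (y n) (2 * i + 5)) =
      (\<lambda>i. if i < Suc n then y i else e (2 * i + 5))" for x y
  proof -
    have "2 * i + 4 \<noteq> 2 * n + 5" "2 * i + 5 \<noteq> 2 * n + 4" for i by presburger+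
    then show "(\<lambda>i. if i < n then x i else ?e (x n) (y n) (2 * i + 4)) =
        (\<lambda>i. if i < Suc n then x i else e (2 * i + 4))"
      "(\<lambda>i. if i < n then y i else ?e (x n) (y n) (2 * i + 5)) =
        (\<lambda>i. if i < Suc n then y i else e (2 * i + 5))"
      by (auto simp: fun_eq_iff less_Suc_eq)
  qed
  have vars: "?e u v 0 = e 0" "?e u v 1 = e 1" "?e u v 2 = e 2" for u v by auto
  show ?case
  proof
    assume L: "bsat e (btransfer \<phi> (Suc n))"
    show "\<forall>x y. (\<forall>i<Suc n. x i \<in> elts (e 1) \<and> y i \<in> elts (e 2) \<and> kpair (x i) (y i) \<in> elts (e 0)) \<longrightarrow>
        (bsat (\<lambda>i. if i < Suc n then x i else e (2 * i + 4)) \<phi> \<longleftrightarrow>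
         bsat (\<lambda>i. if i < Suc n then y i else e (2 * i + 5)) \<phi>)"
    proof (intro allI impI)
      fix x y
      assume xy: "\<forall>i<Suc n. x i \<in> elts (e 1) \<and> y i \<in> elts (e 2) \<and> kpair (x i) (y i) \<in> elts (e 0)"
      then have "bsat (?e (x n) (y n)) (btransfer \<phi> n)" using L step by blast
      from this[unfolded Suc.IH vars, rule_format, of x y, unfolded env]
      show "bsat (\<lambda>i. if i < Suc n then x i else e (2 * i + 4)) \<phi> \<longleftrightarrow>
         bsat (\<lambda>i. if i < Suc n then y i else e (2 * i + 5)) \<phi>" using xy by simp
    qed
  next
    assume R: "\<forall>x y. (\<forall>i<Suc n. x i \<in> elts (e 1) \<and> y i \<in> elts (e 2) \<and> kpair (x i) (y i) \<in> elts (e 0)) \<longrightarrow>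
        (bsat (\<lambda>i. if i < Suc n then x i else e (2 * i + 4)) \<phi> \<longleftrightarrow>
         bsat (\<lambda>i. if i < Suc n then y i else e (2 * i + 5)) \<phi>)"
    show "bsat e (btransfer \<phi> (Suc n))"
      unfolding step Suc.IH vars
    proof (intro ballI impI allI)
      fix u v x y
      assume uv: "u \<in> elts (e 1)" "v \<in> elts (e 2)" "kpair u v \<in> elts (e 0)"
        and xy: "\<forall>i<n. x i \<in> elts (e 1) \<and> y i \<in> elts (e 2) \<and> kpair (x i) (y i) \<in> elts (e 0)"
      have "(\<lambda>i. if i < n then x i else ?e u v (2 * i + 4)) =
          (\<lambda>i. if i < Suc n then (x(n := u)) i else e (2 * i + 4))"
        using env(1)[of "x(n := u)" "y(n := v)"] by (auto simp: fun_eq_iff)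
      moreover have "(\<lambda>i. if i < n then y i else ?e u v (2 * i + 5)) =
          (\<lambda>i. if i < Suc n then (y(n := v)) i else e (2 * i + 5))"
        using env(2)[of "y(n := v)" "x(n := u)"] by (auto simp: fun_eq_iff)
      moreover have "\<forall>i<Suc n. (x(n := u)) i \<in> elts (e 1) \<and> (y(n := v)) i \<in> elts (e 2) \<and>
          kpair ((x(n := u)) i) ((y(n := v)) i) \<in> elts (e 0)"
        using uv xy by (simp add: less_Suc_eq)
      ultimately show "bsat (\<lambda>i. if i < n then x i else ?e u v (2 * i + 4)) \<phi> \<longleftrightarrow>
          bsat (\<lambda>i. if i < n then y i else ?e u v (2 * i + 5)) \<phi>"
        using R by presburger
    qed
  qed
qed

text \<open>All variables other than 1 and 2 take the value x, so the environment stays in V as soon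
  as the three sets do.\<close>

definition env3 :: "'v \<Rightarrow> 'v \<Rightarrow> 'v \<Rightarrow> nat \<Rightarrow> 'v" where
  "env3 x y z i = (if i = 1 then y else if i = 2 then z else x)"

lemma env3_simps [simp]:
  "env3 x y z 0 = x" "env3 x y z 1 = y" "env3 x y z (Suc 0) = y" "env3 x y z 2 = z"
  "env3 x y z (2 * i + 4) = x" "env3 x y z (2 * i + 5) = x"
  by (simp_all add: env3_def)

section \<open>Embeddings of the stage and their application\<close>

context limit_stage
begin

definition bounded_emb :: "('v \<Rightarrow> 'v) \<Rightarrow> bool" where
  "bounded_emb f \<longleftrightarrow> f ` V \<subseteq> V \<and>
     (\<forall>(\<phi>::nat bfm) e. (\<forall>i. e i \<in> V) \<longrightarrow> (bsat e \<phi> \<longleftrightarrow> bsat (f \<circ> e) \<phi>))"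

lemma bounded_emb_in: "bounded_emb f \<Longrightarrow> x \<in> V \<Longrightarrow> f x \<in> V"
  unfolding bounded_emb_def by blast

lemma bounded_emb_bsat:
  fixes \<phi> :: "nat bfm"
  shows "bounded_emb f \<Longrightarrow> (\<And>i. e i \<in> V) \<Longrightarrow> bsat (f \<circ> e) \<phi> \<longleftrightarrow> bsat e \<phi>"
  unfolding bounded_emb_def by blast

lemma bounded_emb3:
  fixes \<phi> :: "nat bfm"
  assumes "bounded_emb f" "x \<in> V" "y \<in> V" "z \<in> V"
  shows "bsat (env3 (f x) (f y) (f z)) \<phi> \<longleftrightarrow> bsat (env3 x y z) \<phi>"
proof -
  have "f \<circ> env3 x y z = env3 (f x) (f y) (f z)" by (auto simp: env3_def)
  then show ?thesis
    using bounded_emb_bsat[OF assms(1), of "env3 x y z" \<phi>] assms by (simp add: env3_def)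
qed

lemma emb_mem: "bounded_emb f \<Longrightarrow> x \<in> V \<Longrightarrow> y \<in> V \<Longrightarrow> f x \<in> elts (f y) \<longleftrightarrow> x \<in> elts y"
  using bounded_emb3[of f x y x "BMem 0 1"] by simp

lemma emb_subset:
  "bounded_emb f \<Longrightarrow> x \<in> V \<Longrightarrow> y \<in> V \<Longrightarrow> elts (f x) \<subseteq> elts (f y) \<longleftrightarrow> elts x \<subseteq> elts y"
  using bounded_emb3[of f x y x "BBall 3 0 (BMem 3 1)"] by (simp add: subset_iff Ball_def)

lemma emb_kpair: "bounded_emb f \<Longrightarrow> x \<in> V \<Longrightarrow> y \<in> V \<Longrightarrow> f (kpair x y) = kpair (f x) (f y)"
  using bounded_emb3[of f "kpair x y" x y "BPair 0 1 2"] V_kpair by simp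

lemma emb_ordinal: "bounded_emb f \<Longrightarrow> \<alpha> \<in> elts \<Lambda> \<Longrightarrow> f \<alpha> \<in> elts \<Lambda>"
  and emb_Vset: "bounded_emb f \<Longrightarrow> \<alpha> \<in> elts \<Lambda> \<Longrightarrow> f (Vset \<alpha>) = Vset (f \<alpha>)"
proof -
  assume f: "bounded_emb f" and \<alpha>: "\<alpha> \<in> elts \<Lambda>"
  have *: "ordinal (f \<alpha>) \<and> elts (f (Vset \<alpha>)) = Vlevel (f \<alpha>)"
    using bounded_emb3[OF f Vset_in_V[OF \<alpha>] ordinals_in_V[OF \<alpha>] ordinals_in_V[OF \<alpha>], of "BLev 0 1"]
    by (simp add: \<alpha> ord elts_Vset_L)
  then show "f \<alpha> \<in> elts \<Lambda>" using ordinal_mem_Vlevel bounded_emb_in[OF f ordinals_in_V[OF \<alpha>]] by blast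
  show "f (Vset \<alpha>) = Vset (f \<alpha>)" using * by (simp add: elts_Vset elts_eq_iff[symmetric])
qed

lemma emb_is_function:
  assumes "bounded_emb f" "g \<in> V" "x \<in> V" "y \<in> V" "is_function g (elts x) (elts y)"
  shows "is_function (f g) (elts (f x)) (elts (f y))"
  using bounded_emb3[OF assms(1-4), of bfunction] assms(5) by (simp add: bsat_bfunction)

lemma emb_ge:
  assumes "bounded_emb f" "\<alpha> \<in> elts \<Lambda>"
  shows "\<alpha> \<in> elts (f \<alpha>) \<or> \<alpha> = f \<alpha>"
  using assms(2)
proof (induction \<alpha> rule: elts_induct)
  case (step \<alpha>)
  have f\<alpha>: "f \<alpha> \<in> elts \<Lambda>" using emb_ordinal assms(1) step.prems by blast
  show ?case
  proof (rule ccontr)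
    assume "\<not> ?thesis"
    then have lt: "f \<alpha> \<in> elts \<alpha>" using ordinal_linear[OF ord[OF step.prems] ord[OF f\<alpha>]] by blast
    then have "f (f \<alpha>) \<in> elts (f \<alpha>)"
      using emb_mem[OF assms(1)] f\<alpha> step.prems ordinals_in_V by blast
    then show False using step.IH[OF lt f\<alpha>] mem_not_sym mem_not_refl by metis
  qed
qed

lemma function_in_V:
  assumes "is_function g (Vlevel \<alpha>) (Vlevel \<beta>)" "\<alpha> \<in> elts \<Lambda>" "\<beta> \<in> elts \<Lambda>"
  shows "g \<in> V"
proof -
  obtain \<gamma> where \<gamma>: "\<gamma> \<in> elts \<Lambda>" "\<alpha> \<in> elts \<gamma>" "\<beta> \<in> elts \<gamma>" using L_upper2 assms by blast
  obtain \<delta> where \<delta>: "\<delta> \<in> elts \<Lambda>" "\<forall>x\<in>Vlevel \<gamma>. \<forall>y\<in>Vlevel \<gamma>. kpair x y \<in> Vlevel \<delta>"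
    using level_kpair \<gamma> by blast
  have "Vlevel \<alpha> \<subseteq> Vlevel \<gamma>" "Vlevel \<beta> \<subseteq> Vlevel \<gamma>" using Vlevel_mono ord \<gamma> by blast+
  then have "elts g \<subseteq> Vlevel \<delta>" using assms(1) \<delta>(2) unfolding is_function_def by blast
  then show ?thesis using V_subset_level \<delta> by blast
qed

definition emb :: "'v \<Rightarrow> bool" where
  "emb k \<longleftrightarrow> is_function k V V \<and> bounded_emb (val k)"

abbreviation rs :: "'v \<Rightarrow> 'v \<Rightarrow> 'v" where
  "rs k \<alpha> \<equiv> restr k (Vlevel \<alpha>)"

lemma elts_rs:
  assumes "emb k" "\<alpha> \<in> elts \<Lambda>"
  shows "elts (rs k \<alpha>) = {kpair x (val k x) | x. x \<in> Vlevel \<alpha>}"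
  using restr_function[of k V V "Vlevel \<alpha>"] assms level_subset_V emb_def by auto

lemma rs_function:
  assumes "emb k" "\<alpha> \<in> elts \<Lambda>"
  shows "is_function (rs k \<alpha>) (Vlevel \<alpha>) (Vlevel (val k \<alpha>))"
proof (rule is_functionI(1)[OF elts_rs[OF assms]])
  fix x assume x: "x \<in> Vlevel \<alpha>"
  have f: "bounded_emb (val k)" using assms emb_def by blast
  have "val k x \<in> elts (val k (Vset \<alpha>))"
    using emb_mem[OF f, of x "Vset \<alpha>"] x Vset_in_V level_subset_V assms elts_Vset_L by blast
  then show "val k x \<in> Vlevel (val k \<alpha>)"
    using emb_Vset[OF f] emb_ordinal[OF f] assms(2) elts_Vset_L by simp
qed

lemma rs_in_V: "emb k \<Longrightarrow> \<alpha> \<in> elts \<Lambda> \<Longrightarrow> rs k \<alpha> \<in> V"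
  using function_in_V rs_function emb_ordinal emb_def by blast

lemma val_rs_function:
  assumes "emb a" "emb b" "\<alpha> \<in> elts \<Lambda>"
  shows "is_function (val a (rs b \<alpha>)) (Vlevel (val a \<alpha>)) (Vlevel (val a (val b \<alpha>)))"
proof -
  have f: "bounded_emb (val a)" and b: "val b \<alpha> \<in> elts \<Lambda>" using assms emb_def emb_ordinal by blast+
  have "is_function (val a (rs b \<alpha>)) (elts (val a (Vset \<alpha>))) (elts (val a (Vset (val b \<alpha>))))"
    by (rule emb_is_function[OF f rs_in_V Vset_in_V Vset_in_V])
      (use assms b rs_function elts_Vset_L in auto)
  then show ?thesis
    using emb_Vset[OF f] emb_ordinal[OF f] assms(3) b elts_Vset_L by simp
qed

lemma elts_appl:
  assumes "emb a" "emb b"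
  shows "elts (appl \<Lambda> a b) = (\<Union>\<alpha>\<in>elts \<Lambda>. elts (val a (rs b \<alpha>)))"
  unfolding appl_def
proof (rule elts_vset[OF small_subset[OF small_Vlevel[OF ord_L]]])
  show "(\<Union>\<alpha>\<in>elts \<Lambda>. elts (val a (rs b \<alpha>))) \<subseteq> V"
  proof (intro UN_least subsetI)
    fix \<alpha> p assume "\<alpha> \<in> elts \<Lambda>" "p \<in> elts (val a (rs b \<alpha>))"
    moreover have "val a (rs b \<alpha>) \<in> V"
      using bounded_emb_in[OF _ rs_in_V[OF assms(2) \<open>\<alpha> \<in> elts \<Lambda>\<close>]] assms(1) emb_def by simp
    ultimately show "p \<in> V" using V_mem by simp
  qed
qed

lemma val_rs_mono:
  assumes "emb a" "emb b" "\<beta> \<in> elts \<Lambda>" "\<alpha> \<in> elts \<beta>"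
  shows "elts (val a (rs b \<alpha>)) \<subseteq> elts (val a (rs b \<beta>))"
proof -
  have \<alpha>: "\<alpha> \<in> elts \<Lambda>" using assms ord_L ordinal_trans by blast
  have "elts (rs b \<alpha>) \<subseteq> elts (rs b \<beta>)"
    using Vlevel_mono[OF ord[OF assms(3)]] assms(4) by (auto simp: elts_restr)
  then show ?thesis
    using emb_subset[of "val a"] assms \<alpha> rs_in_V emb_def by blast
qed

lemma level_emb: "emb a \<Longrightarrow> \<alpha> \<in> elts \<Lambda> \<Longrightarrow> Vlevel \<alpha> \<subseteq> Vlevel (val a \<alpha>)"
  using emb_ge emb_ordinal Vlevel_mono ord unfolding emb_def by blast

text \<open>The images a(b restricted to V_\<alpha>) form an increasing family of functions, so
  their union is a function; since a(\<alpha>) \<ge> \<alpha>, the domains exhaust V.\<close>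

lemma appl_function:
  assumes a: "emb a" and b: "emb b"
  shows "is_function (appl \<Lambda> a b) V V"
    and "\<And>\<alpha> x. \<alpha> \<in> elts \<Lambda> \<Longrightarrow> x \<in> Vlevel (val a \<alpha>) \<Longrightarrow>
           val (appl \<Lambda> a b) x = val (val a (rs b \<alpha>)) x"
proof -
  note fn = val_rs_function[OF a b]
  have fa: "bounded_emb (val a)" and fb: "bounded_emb (val b)" using a b emb_def by blast+
  have pair: "kpair x y \<in> elts (appl \<Lambda> a b) \<longleftrightarrow>
      (\<exists>\<alpha>\<in>elts \<Lambda>. x \<in> Vlevel (val a \<alpha>) \<and> y = val (val a (rs b \<alpha>)) x)" for x y
    using is_function_mem_iff[OF fn] by (auto simp: elts_appl[OF a b])
  have agree: "val (val a (rs b \<alpha>)) x = val (val a (rs b \<beta>)) x"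
    if "\<alpha> \<in> elts \<Lambda>" "\<beta> \<in> elts \<Lambda>" "x \<in> Vlevel (val a \<alpha>)" "x \<in> Vlevel (val a \<beta>)" for \<alpha> \<beta> x
  proof -
    have *: "val (val a (rs b \<alpha>)) x = val (val a (rs b \<beta>)) x"
      if "\<beta> \<in> elts \<Lambda>" "\<alpha> \<in> elts \<Lambda>" "\<alpha> \<in> elts \<beta>" "x \<in> Vlevel (val a \<alpha>)" for \<alpha> \<beta>
    proof -
      have "kpair x (val (val a (rs b \<alpha>)) x) \<in> elts (val a (rs b \<alpha>))"
        using is_function_mem_iff[OF fn] that by blast
      then have "kpair x (val (val a (rs b \<alpha>)) x) \<in> elts (val a (rs b \<beta>))"
        using val_rs_mono[OF a b that(1,3)] by blast
      then show ?thesis using is_function_mem_iff[OF fn[OF that(1)]] by blast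
    qed
    show ?thesis using ordinal_linear[OF ord ord, OF that(1,2)] *[of \<alpha> \<beta>] *[of \<beta> \<alpha>] that by auto
  qed
  show v: "val (appl \<Lambda> a b) x = val (val a (rs b \<alpha>)) x"
    if "\<alpha> \<in> elts \<Lambda>" "x \<in> Vlevel (val a \<alpha>)" for \<alpha> x
    unfolding val_def[of "appl \<Lambda> a b"] pair
    by (rule the_equality) (use that agree in blast)+
  have sub: "elts (appl \<Lambda> a b) \<subseteq> {kpair x y |x y. x \<in> V \<and> y \<in> V}"
  proof -
    have "elts (val a (rs b \<alpha>)) \<subseteq> {kpair x y |x y. x \<in> V \<and> y \<in> V}" if "\<alpha> \<in> elts \<Lambda>" for \<alpha>
    proof -
      have "Vlevel (val a \<alpha>) \<subseteq> V" "Vlevel (val a (val b \<alpha>)) \<subseteq> V"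
        using emb_ordinal[OF fa] emb_ordinal[OF fb] that level_subset_V by auto
      then show ?thesis using fn[OF that] unfolding is_function_def by blast
    qed
    then show ?thesis unfolding elts_appl[OF a b] by blast
  qed
  show "is_function (appl \<Lambda> a b) V V"
    unfolding is_function_def pair
  proof (intro conjI ballI sub)
    fix x assume "x \<in> V"
    then obtain \<alpha> where "\<alpha> \<in> elts \<Lambda>" "x \<in> Vlevel \<alpha>" using V_level by blast
    then have "\<alpha> \<in> elts \<Lambda>" "x \<in> Vlevel (val a \<alpha>)" using level_emb[OF a] by auto
    then show "\<exists>!y. \<exists>\<alpha>\<in>elts \<Lambda>. x \<in> Vlevel (val a \<alpha>) \<and> y = val (val a (rs b \<alpha>)) x"
      using agree by blast
  qed
qed

text \<open>Apply a to the membership of the pair (x, b(x)) in a restriction of b.\<close>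

lemma appl_emb_val:
  assumes a: "emb a" and b: "emb b" and x: "x \<in> V"
  shows "val (appl \<Lambda> a b) (val a x) = val a (val b x)"
proof -
  obtain \<alpha> where \<alpha>: "\<alpha> \<in> elts \<Lambda>" "x \<in> Vlevel \<alpha>" using V_level x by blast
  have fa: "bounded_emb (val a)" and fb: "bounded_emb (val b)" using a b emb_def by blast+
  have "kpair x (val b x) \<in> elts (rs b \<alpha>)" using elts_rs[OF b \<alpha>(1)] \<alpha>(2) by blast
  then have "val a (kpair x (val b x)) \<in> elts (val a (rs b \<alpha>))"
    using emb_mem[OF fa V_kpair[OF x bounded_emb_in[OF fb x]] rs_in_V[OF b \<alpha>(1)]] by simp
  then have "kpair (val a x) (val a (val b x)) \<in> elts (val a (rs b \<alpha>))"
    using emb_kpair[OF fa] x bounded_emb_in[OF fb] by simp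
  then have "val a x \<in> Vlevel (val a \<alpha>)" "val a (val b x) = val (val a (rs b \<alpha>)) (val a x)"
    using is_function_mem_iff[OF val_rs_function[OF a b \<alpha>(1)]] by blast+
  then show ?thesis using appl_function(2)[OF a b \<alpha>(1)] by simp
qed

lemma common_level:
  assumes "\<And>i. i < (n::nat) \<Longrightarrow> e i \<in> V"
  shows "\<exists>\<alpha>\<in>elts \<Lambda>. \<forall>i<n. e i \<in> Vlevel \<alpha>"
  using assms
proof (induction n)
  case 0
  then show ?case using limit by (auto simp: limit_ordinal_def)
next
  case (Suc n)
  then obtain \<alpha> \<beta> where ab: "\<alpha> \<in> elts \<Lambda>" "\<forall>i<n. e i \<in> Vlevel \<alpha>" "\<beta> \<in> elts \<Lambda>" "e n \<in> Vlevel \<beta>"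
    using V_level[of "e n"] by auto
  then obtain \<gamma> where "\<gamma> \<in> elts \<Lambda>" "\<alpha> \<in> elts \<gamma>" "\<beta> \<in> elts \<gamma>" using L_upper2 by blast
  moreover have "Vlevel \<alpha> \<subseteq> Vlevel \<gamma>" "Vlevel \<beta> \<subseteq> Vlevel \<gamma>"
    using calculation Vlevel_mono ord by blast+
  ultimately show ?case using ab by (auto simp: less_Suc_eq)
qed

text \<open>That b preserves \<phi> on V_\<alpha> is a bounded assertion about the restriction of b,
  V_\<alpha> and V_b(\<alpha>), namely \<open>btransfer\<close>. Its image under a says that a(b
  restricted to V_\<alpha>), a part of a(b), preserves \<phi> on V_a(\<alpha>).\<close>

lemma emb_appl:
  assumes a: "emb a" and b: "emb b"
  shows "emb (appl \<Lambda> a b)"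
  unfolding emb_def bounded_emb_def
proof (intro conjI allI impI)
  note fn = appl_function(1)[OF a b]
  show "is_function (appl \<Lambda> a b) V V" by (rule fn)
  then show "val (appl \<Lambda> a b) ` V \<subseteq> V" using is_function_val by blast
  fix \<phi> :: "nat bfm" and e :: "nat \<Rightarrow> 'v"
  assume e: "\<forall>i. e i \<in> V"
  have fa: "bounded_emb (val a)" and fb: "bounded_emb (val b)" using a b emb_def by blast+
  obtain n where n: "\<And>i. i \<in> set_bfm \<phi> \<Longrightarrow> i < n"
    using finite_set_bfm[of \<phi>] by (metis finite_nat_set_iff_bounded)
  \<comment> \<open>Only the finitely many parameters that \<phi> mentions have to lie in one level;
    the others may be unbounded.\<close>
  obtain \<alpha> where \<alpha>: "\<alpha> \<in> elts \<Lambda>" "\<forall>i<n. e i \<in> Vlevel \<alpha>" using common_level e by blast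
  have b\<alpha>: "val b \<alpha> \<in> elts \<Lambda>" using emb_ordinal fb \<alpha> by blast
  let ?g = "rs b \<alpha>" and ?U = "Vset \<alpha>" and ?W = "Vset (val b \<alpha>)"
  have U: "elts ?U = Vlevel \<alpha>" using elts_Vset_L \<alpha> by blast
  have V3: "?g \<in> V" "?U \<in> V" "?W \<in> V" using rs_in_V Vset_in_V \<alpha> b b\<alpha> by auto
  have "bsat (env3 ?g ?U ?W) (btransfer \<phi> n)"
    unfolding bsat_btransfer
  proof (intro allI impI)
    fix x y :: "nat \<Rightarrow> 'v"
    assume xy: "\<forall>i<n. x i \<in> elts ((env3 ?g ?U ?W) 1) \<and>
      y i \<in> elts ((env3 ?g ?U ?W) 2) \<and> kpair (x i) (y i) \<in> elts ((env3 ?g ?U ?W) 0)"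
    have i: "x i \<in> V \<and> y i = val b (x i)" if "i < n" for i
      using xy that U level_subset_V \<alpha> by (auto simp: elts_rs[OF b \<alpha>(1)])
    let ?x = "\<lambda>i. if i < n then x i else ?g"
    have 1: "bsat (val b \<circ> ?x) \<phi> \<longleftrightarrow> bsat ?x \<phi>"
      by (rule bounded_emb_bsat[OF fb]) (use i V3 in auto)
    have 2: "bsat (\<lambda>i. if i < n then x i else w i) \<phi> \<longleftrightarrow> bsat ?x \<phi>" for w
      by (rule bsat_cong) (use n in auto)
    have 3: "bsat (\<lambda>i. if i < n then y i else w i) \<phi> \<longleftrightarrow> bsat (val b \<circ> ?x) \<phi>" for w
      by (rule bsat_cong) (use n i in auto)
    show "bsat (\<lambda>i. if i < n then x i else (env3 ?g ?U ?W) (2 * i + 4)) \<phi> \<longleftrightarrow>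
      bsat (\<lambda>i. if i < n then y i else (env3 ?g ?U ?W) (2 * i + 5)) \<phi>" 
      using 1 2[of "\<lambda>i. env3 ?g ?U ?W (2 * i + 4)"] 3[of "\<lambda>i. env3 ?g ?U ?W (2 * i + 5)"] by blast
  qed
  then have T: "bsat (env3 (val a ?g) (val a ?U) (val a ?W)) (btransfer \<phi> n)"
    using bounded_emb3[OF fa V3] by blast
  have lev: "elts (val a ?U) = Vlevel (val a \<alpha>)" "elts (val a ?W) = Vlevel (val a (val b \<alpha>))"
    using emb_Vset[OF fa] emb_ordinal[OF fa] \<alpha> b\<alpha> elts_Vset_L by auto
  have "kpair (e i) (val (appl \<Lambda> a b) (e i)) \<in> elts (val a ?g) \<and> e i \<in> Vlevel (val a \<alpha>)
      \<and> val (appl \<Lambda> a b) (e i) \<in> Vlevel (val a (val b \<alpha>))" if "i < n" for i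
  proof -
    have x: "e i \<in> Vlevel (val a \<alpha>)" using \<alpha> that level_emb[OF a] by blast
    then show ?thesis
      unfolding appl_function(2)[OF a b \<alpha>(1) x]
      using is_function_mem_iff[OF val_rs_function[OF a b \<alpha>(1)]]
        is_function_val[OF val_rs_function[OF a b \<alpha>(1)] x] by blast
  qed
  then have "bsat (\<lambda>i. if i < n then e i else val a ?g) \<phi> \<longleftrightarrow>
      bsat (\<lambda>i. if i < n then val (appl \<Lambda> a b) (e i) else val a ?g) \<phi>"
    using T[unfolded bsat_btransfer env3_simps, rule_format, of e "\<lambda>i. val (appl \<Lambda> a b) (e i)"] lev
    by simp
  moreover have "bsat (\<lambda>i. if i < n then e i else val a ?g) \<phi> \<longleftrightarrow> bsat e \<phi>"
    by (rule bsat_cong) (use n in auto)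
  moreover have "bsat (\<lambda>i. if i < n then val (appl \<Lambda> a b) (e i) else val a ?g) \<phi> \<longleftrightarrow>
      bsat (val (appl \<Lambda> a b) \<circ> e) \<phi>"
    by (rule bsat_cong) (use n in auto)
  ultimately show "bsat e \<phi> \<longleftrightarrow> bsat (val (appl \<Lambda> a b) \<circ> e) \<phi>" by blast
qed

lemma emb_ext:
  assumes "emb a" "emb b" "\<And>x. x \<in> V \<Longrightarrow> val a x = val b x"
  shows "a = b"
proof -
  have "elts a = elts b"
    using is_function_elts[of a V V] is_function_elts[of b V V] assms emb_def by auto
  then show ?thesis by (simp add: elts_eq_iff)
qed

lemma val_rs_eq_rs:
  assumes "emb a" "emb b" "\<alpha> \<in> elts \<Lambda>"
  shows "val a (rs b \<alpha>) = rs (appl \<Lambda> a b) (val a \<alpha>)"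
proof -
  have a\<alpha>: "val a \<alpha> \<in> elts \<Lambda>" using assms emb_ordinal emb_def by blast
  have "elts (val a (rs b \<alpha>)) = elts (rs (appl \<Lambda> a b) (val a \<alpha>))"
    using is_function_elts[OF val_rs_function[OF assms]] elts_rs[OF emb_appl[OF assms(1,2)] a\<alpha>]
      appl_function(2)[OF assms] by auto
  then show ?thesis by (simp add: elts_eq_iff)
qed

text \<open>Write c_\<alpha> for the restriction of c to V_\<alpha>. Locally both sides are values
  of one set: (a \<cdot> b)(a(c_\<alpha>)) = a(b(c_\<alpha>)), where a(c_\<alpha>) and b(c_\<alpha>)
  are restrictions of a \<cdot> c and b \<cdot> c by \<open>val_rs_eq_rs\<close>.\<close>

lemma appl_ldist:
  assumes a: "emb a" and b: "emb b" and c: "emb c"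
  shows "appl \<Lambda> a (appl \<Lambda> b c) = appl \<Lambda> (appl \<Lambda> a b) (appl \<Lambda> a c)"
proof (rule emb_ext)
  fix x assume "x \<in> V"
  then obtain \<alpha> where \<alpha>: "\<alpha> \<in> elts \<Lambda>" "x \<in> Vlevel \<alpha>" using V_level by blast
  have b\<alpha>: "val b \<alpha> \<in> elts \<Lambda>" and a\<alpha>: "val a \<alpha> \<in> elts \<Lambda>"
    using \<alpha> a b emb_ordinal emb_def by blast+
  have x: "x \<in> Vlevel (val a (val b \<alpha>))"
    using level_emb[OF b \<alpha>(1)] level_emb[OF a b\<alpha>] \<alpha>(2) by blast
  have "val (appl \<Lambda> a b) (rs (appl \<Lambda> a c) (val a \<alpha>)) = val (appl \<Lambda> a b) (val a (rs c \<alpha>))"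
    using val_rs_eq_rs[OF a c \<alpha>(1)] by simp
  also have "\<dots> = val a (val b (rs c \<alpha>))" using appl_emb_val[OF a b] rs_in_V c \<alpha> by blast
  also have "\<dots> = val a (rs (appl \<Lambda> b c) (val b \<alpha>))" using val_rs_eq_rs[OF b c \<alpha>(1)] by simp
  finally have *: "val (appl \<Lambda> a b) (rs (appl \<Lambda> a c) (val a \<alpha>)) = val a (rs (appl \<Lambda> b c) (val b \<alpha>))" .
  have "val (appl \<Lambda> a b) (val a \<alpha>) = val a (val b \<alpha>)"
    using appl_emb_val[OF a b ordinals_in_V[OF \<alpha>(1)]] .
  then show "val (appl \<Lambda> a (appl \<Lambda> b c)) x = val (appl \<Lambda> (appl \<Lambda> a b) (appl \<Lambda> a c)) x"
    using appl_function(2)[OF a emb_appl[OF b c] b\<alpha> x]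
      appl_function(2)[OF emb_appl[OF a b] emb_appl[OF a c] a\<alpha>, of x] x * by simp
qed (use assms emb_appl in auto)

section \<open>Critical points\<close>

definition moving :: "'v \<Rightarrow> bool" where
  "moving k \<longleftrightarrow> emb k \<and> (\<exists>\<alpha>\<in>elts \<Lambda>. val k \<alpha> \<noteq> \<alpha>)"

lemma crit_unique:
  assumes "emb k" "\<alpha> \<in> elts \<Lambda>" "val k \<alpha> \<noteq> \<alpha>" "\<And>\<beta>. \<beta> \<in> elts \<alpha> \<Longrightarrow> val k \<beta> = \<beta>"
  shows "crit \<Lambda> k = \<alpha>"
  unfolding crit_def ord_less_def
proof (rule the_equality)
  fix \<alpha>' assume "\<alpha>' \<in> elts \<Lambda> \<and> val k \<alpha>' \<noteq> \<alpha>' \<and> (\<forall>\<beta>. \<beta> \<in> elts \<alpha>' \<longrightarrow> val k \<beta> = \<beta>)"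
  then show "\<alpha>' = \<alpha>" using ordinal_linear[OF ord ord, of \<alpha>' \<alpha>] assms by blast
qed (use assms in auto)

lemma crit_props:
  assumes "moving k"
  shows "crit \<Lambda> k \<in> elts \<Lambda>" "val k (crit \<Lambda> k) \<noteq> crit \<Lambda> k"
    "\<And>\<beta>. \<beta> \<in> elts (crit \<Lambda> k) \<Longrightarrow> val k \<beta> = \<beta>"
proof -
  obtain \<alpha> where "\<alpha> \<in> elts \<Lambda> \<and> val k \<alpha> \<noteq> \<alpha>" using assms moving_def by blast
  then obtain \<kappa> where \<kappa>: "\<kappa> \<in> elts \<Lambda>" "val k \<kappa> \<noteq> \<kappa>" "\<And>\<beta>. \<beta> \<in> elts \<kappa> \<Longrightarrow> \<not> (\<beta> \<in> elts \<Lambda> \<and> val k \<beta> \<noteq> \<beta>)"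
    using wfE_min[OF foundation, of \<alpha> "{\<alpha>. \<alpha> \<in> elts \<Lambda> \<and> val k \<alpha> \<noteq> \<alpha>}"] by auto
  then have fixd: "val k \<beta> = \<beta>" if "\<beta> \<in> elts \<kappa>" for \<beta> using that ordinal_trans[OF ord_L] by blast
  have "crit \<Lambda> k = \<kappa>" by (rule crit_unique) (use assms \<kappa> fixd moving_def in auto)
  then show "crit \<Lambda> k \<in> elts \<Lambda>" "val k (crit \<Lambda> k) \<noteq> crit \<Lambda> k"
    "\<And>\<beta>. \<beta> \<in> elts (crit \<Lambda> k) \<Longrightarrow> val k \<beta> = \<beta>" using \<kappa> fixd by auto
qed

lemma crit_less_val: "moving k \<Longrightarrow> crit \<Lambda> k \<in> elts (val k (crit \<Lambda> k))"
  using crit_props emb_ge unfolding moving_def emb_def by metis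

text \<open>With \<kappa> = crit b, the ordinal a(\<kappa>) is moved, since (a \<cdot>
  b)(a(\<kappa>)) = a(b(\<kappa>)) > a(\<kappa>). That b is the identity below \<kappa> is a bounded
  fact about a restriction of b and \<kappa>, which a carries over.\<close>

lemma crit_appl:
  assumes "moving a" "moving b"
  shows "moving (appl \<Lambda> a b)" "crit \<Lambda> (appl \<Lambda> a b) = val a (crit \<Lambda> b)"
proof -
  let ?k = "crit \<Lambda> b"
  have a: "emb a" and b: "emb b" and fa: "bounded_emb (val a)" and fb: "bounded_emb (val b)"
    using assms moving_def emb_def by blast+
  have k: "?k \<in> elts \<Lambda>" "val b ?k \<in> elts \<Lambda>" "val a ?k \<in> elts \<Lambda>"
    using crit_props[OF assms(2)] emb_ordinal fa fb by blast+
  have "val a ?k \<in> elts (val a (val b ?k))"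
    using emb_mem[OF fa] k ordinals_in_V crit_less_val[OF assms(2)] by blast
  then have mv: "val (appl \<Lambda> a b) (val a ?k) \<noteq> val a ?k"
    using appl_emb_val[OF a b] k ordinals_in_V mem_not_refl by metis
  then show "moving (appl \<Lambda> a b)" using emb_appl[OF a b] k moving_def by blast
  obtain \<alpha> where \<alpha>: "\<alpha> \<in> elts \<Lambda>" "?k \<in> elts \<alpha>" using L_succ k by blast
  have V3: "rs b \<alpha> \<in> V" "?k \<in> V" using rs_in_V b \<alpha> k ordinals_in_V by blast+
  have "kpair x x \<in> elts (rs b \<alpha>)" if "x \<in> elts ?k" for x
  proof -
    have "x \<in> elts \<alpha>" using that \<alpha> ordinal_trans[OF ord[OF \<alpha>(1)]] by blast
    then have "x \<in> Vlevel \<alpha>" using ordinal_mem_Vlevel ordinal_mem[OF ord[OF \<alpha>(1)]] by blast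
    then show ?thesis using elts_rs[OF b \<alpha>(1)] crit_props(3)[OF assms(2) that] by fastforce
  qed
  then have id: "kpair x x \<in> elts (val a (rs b \<alpha>))" if "x \<in> elts (val a ?k)" for x
    using that bounded_emb3[OF fa V3(1,2,2), of "BBall 3 1 (BEx 4 0 (BPair 4 3 3))"] by auto
  show "crit \<Lambda> (appl \<Lambda> a b) = val a ?k"
  proof (rule crit_unique[OF emb_appl[OF a b] k(3) mv])
    fix \<beta> assume "\<beta> \<in> elts (val a ?k)"
    from id[OF this] show "val (appl \<Lambda> a b) \<beta> = \<beta>"
      using is_function_mem_iff[OF val_rs_function[OF a b \<alpha>(1)]] appl_function(2)[OF a b \<alpha>(1)] by metis
  qed
qed

end

section \<open>Elementary embeddings preserve bounded formulas\<close>

text \<open>Scott's description of the cumulative hierarchy: a history is a set \<open>{V\<^sub>\<beta> | \<beta> < \<alpha>}\<close>, and it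
  determines \<open>V\<^sub>\<alpha>\<close> without any coding of the function \<open>\<beta> \<mapsto> V\<^sub>\<beta>\<close>.\<close>

definition history :: "'v::zfc_universe \<Rightarrow> bool" where
  "history h \<longleftrightarrow> (\<forall>x\<in>elts h. elts x = {z. \<exists>y\<in>elts h. y \<in> elts x \<and> elts z \<subseteq> elts y})"

lemma Un_Pow_levels:
  assumes "small S" "\<And>y. y \<in> S \<Longrightarrow> \<exists>\<beta>. ordinal \<beta> \<and> elts y = Vlevel \<beta>"
  shows "\<exists>\<delta>. ordinal \<delta> \<and> {z. \<exists>y\<in>S. elts z \<subseteq> elts y} = Vlevel \<delta>"
proof -
  have lev: "elts y = Vlevel (rank y)" if y: "y \<in> S" for y
  proof -
    obtain \<beta> where "ordinal \<beta>" "elts y = Vlevel \<beta>" using assms(2)[OF y] by blast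
    then show ?thesis using rank_Vset[of \<beta>] by (metis Vset_def vset_elts)
  qed
  obtain \<delta> where \<delta>: "ordinal \<delta>" "Vlevel \<delta> = (\<Union>\<beta>\<in>rank ` S. {z. elts z \<subseteq> Vlevel \<beta>})"
    by (rule Un_Pow_Vlevel[OF small_image[OF assms(1)], of rank]) auto
  have "(\<Union>\<beta>\<in>rank ` S. {z. elts z \<subseteq> Vlevel \<beta>}) = {z. \<exists>y\<in>S. elts z \<subseteq> elts y}"
    using lev by auto
  then show ?thesis using \<delta> by metis
qed

text \<open>By induction on membership, the members of h inside x are levels, and x is the union of
  their power sets.\<close>

lemma history_level:
  assumes "history h" "x \<in> elts h"
  shows "\<exists>\<beta>. ordinal \<beta> \<and> elts x = Vlevel \<beta>"
  using assms(2)
proof (induction x rule: elts_induct)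
  case (step x)
  have "small (elts h \<inter> elts x)" by (rule small_subset[OF small_elts[of h]]) auto
  then obtain \<delta> where \<delta>: "ordinal \<delta>" "{z. \<exists>y\<in>elts h \<inter> elts x. elts z \<subseteq> elts y} = Vlevel \<delta>"
    using Un_Pow_levels[of "elts h \<inter> elts x"] step.IH by blast
  have "elts x = {z. \<exists>y\<in>elts h. y \<in> elts x \<and> elts z \<subseteq> elts y}"
    using assms(1) step.prems unfolding history_def by blast
  also have "\<dots> = {z. \<exists>y\<in>elts h \<inter> elts x. elts z \<subseteq> elts y}" by blast
  finally show ?case using \<delta> by auto
qed

lemma history_levels:
  assumes "ordinal \<alpha>"
  shows "history (vset (Vset ` elts \<alpha>))"
    and "Vlevel \<alpha> = {z. \<exists>y\<in>elts (vset (Vset ` elts \<alpha>)). elts z \<subseteq> elts y}"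
proof -
  have e: "elts (vset (Vset ` elts \<alpha>)) = Vset ` elts \<alpha>" by (simp add: elts_vset small_image)
  have *: "Vlevel \<beta> = {z. \<exists>\<gamma>\<in>elts \<beta>. elts z \<subseteq> elts (Vset \<gamma>)}" if "ordinal \<beta>" for \<beta>
    using Vlevel_eq_UN[OF that] elts_Vset[OF ordinal_mem[OF that]] by auto
  show "Vlevel \<alpha> = {z. \<exists>y\<in>elts (vset (Vset ` elts \<alpha>)). elts z \<subseteq> elts y}"
    unfolding e using *[OF assms] by auto
  show "history (vset (Vset ` elts \<alpha>))"
    unfolding history_def e
  proof (clarify)
    fix \<beta> assume \<beta>: "\<beta> \<in> elts \<alpha>"
    have o: "ordinal \<beta>" using ordinal_mem[OF assms \<beta>] .
    have "\<gamma> \<in> elts \<alpha> \<and> Vset \<gamma> \<in> Vlevel \<beta> \<longleftrightarrow> \<gamma> \<in> elts \<beta>" for \<gamma>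
    proof -
      have "\<gamma> \<in> elts \<alpha>" if "\<gamma> \<in> elts \<beta>" using that assms \<beta> ordinal_trans by blast
      moreover have "ordinal \<gamma>" if "\<gamma> \<in> elts \<alpha>" using that assms ordinal_mem by blast
      ultimately show ?thesis using rank_Vset[of \<gamma>] by (auto simp: mem_Vlevel)
    qed
    then have "{z. \<exists>\<gamma>\<in>elts \<beta>. elts z \<subseteq> elts (Vset \<gamma>)} =
        {z. \<exists>y\<in>Vset ` elts \<alpha>. y \<in> Vlevel \<beta> \<and> elts z \<subseteq> elts y}" by blast
    then show "elts (Vset \<beta>) = {z. \<exists>y\<in>Vset ` elts \<alpha>. y \<in> elts (Vset \<beta>) \<and> elts z \<subseteq> elts y}"
      unfolding elts_Vset[OF o] by (rule trans[OF *[OF o]])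
  qed
qed

section \<open>First-order definitions of pairs and levels\<close>

definition "fImp \<phi> \<psi> = Neg (Conj \<phi> (Neg \<psi>))"
definition "fIff \<phi> \<psi> = Conj (fImp \<phi> \<psi>) (fImp \<psi> \<phi>)"
definition "fDisj \<phi> \<psi> = Neg (Conj (Neg \<phi>) (Neg \<psi>))"
definition "fEx i \<phi> = Neg (All i (Neg \<phi>))"

lemma sat_simps [simp]:
  "sat M e (fImp \<phi> \<psi>) \<longleftrightarrow> (sat M e \<phi> \<longrightarrow> sat M e \<psi>)"
  "sat M e (fIff \<phi> \<psi>) \<longleftrightarrow> (sat M e \<phi> \<longleftrightarrow> sat M e \<psi>)"
  "sat M e (fDisj \<phi> \<psi>) \<longleftrightarrow> (sat M e \<phi> \<or> sat M e \<psi>)"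
  "sat M e (fEx i \<phi>) \<longleftrightarrow> (\<exists>x\<in>M. sat M (e(i := x)) \<phi>)"
  by (auto simp: fImp_def fIff_def fDisj_def fEx_def)

definition fm_pair :: "nat \<Rightarrow> nat \<Rightarrow> nat \<Rightarrow> fm" where
  "fm_pair p x y = All 0 (fIff (Mem 0 p)
     (fDisj (All 1 (fIff (Mem 1 0) (Equal 1 x)))
            (All 1 (fIff (Mem 1 0) (fDisj (Equal 1 x) (Equal 1 y))))))"

definition fm_subset :: "nat \<Rightarrow> nat \<Rightarrow> fm" where
  "fm_subset x y = All 3 (fImp (Mem 3 x) (Mem 3 y))"

definition fm_transitive :: "nat \<Rightarrow> fm" where
  "fm_transitive x = All 5 (fImp (Mem 5 x) (All 6 (fImp (Mem 6 5) (Mem 6 x))))"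

text \<open>Variable 0 is a history whose members generate u by power sets and union; the last
  conjunct says that a is the set of ordinals in u. This forces a to be the ordinal indexing the
  level u.\<close>

definition fm_level :: "nat \<Rightarrow> nat \<Rightarrow> fm" where
  "fm_level u a = Conj
     (fEx 0 (Conj
        (All 4 (fImp (Mem 4 0)
           (All 1 (fIff (Mem 1 4) (fEx 2 (Conj (Mem 2 0) (Conj (Mem 2 4) (fm_subset 1 2))))))))
        (All 1 (fIff (Mem 1 u) (fEx 2 (Conj (Mem 2 0) (fm_subset 1 2)))))))
     (All 1 (fIff (Mem 1 a)
        (Conj (Mem 1 u) (Conj (fm_transitive 1) (All 2 (fImp (Mem 2 1) (fm_transitive 2)))))))"

text \<open>The variables of the bounded formula are shifted by 10, which leaves the variables below 10
  for the quantifiers inside the atoms.\<close>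

primrec fm_of :: "nat bfm \<Rightarrow> fm" where
  "fm_of (BMem i k) = Mem (i + 10) (k + 10)"
| "fm_of (BEq i k) = Equal (i + 10) (k + 10)"
| "fm_of (BPair p x y) = fm_pair (p + 10) (x + 10) (y + 10)"
| "fm_of (BLev u a) = fm_level (u + 10) (a + 10)"
| "fm_of (BNeg \<phi>) = Neg (fm_of \<phi>)"
| "fm_of (BConj \<phi> \<psi>) = Conj (fm_of \<phi>) (fm_of \<psi>)"
| "fm_of (BBall i k \<phi>) =
     (if i = k then fImp (Mem 0 0) (Mem 0 0) else All (i + 10) (fImp (Mem (i + 10) (k + 10)) (fm_of \<phi>)))"

context limit_stage
begin

lemma V_ball [simp]: "x \<in> V \<Longrightarrow> (\<forall>y\<in>V. y \<in> elts x \<longrightarrow> P y) \<longleftrightarrow> (\<forall>y\<in>elts x. P y)"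
  and V_bex [simp]: "x \<in> V \<Longrightarrow> (\<exists>y\<in>V. y \<in> elts x \<and> P y) \<longleftrightarrow> (\<exists>y\<in>elts x. P y)"
  using V_mem by blast+

lemma V_ext: "x \<in> V \<Longrightarrow> S \<subseteq> V \<Longrightarrow> (\<forall>y\<in>V. y \<in> elts x \<longleftrightarrow> y \<in> S) \<longleftrightarrow> elts x = S"
  using V_mem by blast

lemma sat_pair:
  assumes "e p \<in> V" "e x \<in> V" "e y \<in> V" "10 \<le> p" "10 \<le> x" "10 \<le> y"
  shows "sat V e (fm_pair p x y) \<longleftrightarrow> e p = kpair (e x) (e y)"
proof -
  have pv: "vset {e x, e y} \<in> V" "vset {e x} \<in> V" using V_pair[of "e x" "e x"] V_pair assms by simp_all
  have *: "(\<forall>w\<in>V. w \<in> elts z \<longleftrightarrow> w = e x) \<longleftrightarrow> z = vset {e x}"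
    "(\<forall>w\<in>V. w \<in> elts z \<longleftrightarrow> w = e x \<or> w = e y) \<longleftrightarrow> z = vset {e x, e y}" if "z \<in> V" for z
    using V_ext[OF that, of "{e x}"] V_ext[OF that, of "{e x, e y}"] assms
      elts_eq_iff[of z "vset {e x}"] elts_eq_iff[of z "vset {e x, e y}"] by (simp_all add: elts_vset)
  have "sat V e (fm_pair p x y) \<longleftrightarrow> (\<forall>z\<in>V. z \<in> elts (e p) \<longleftrightarrow>
      (\<forall>w\<in>V. w \<in> elts z \<longleftrightarrow> w = e x) \<or> (\<forall>w\<in>V. w \<in> elts z \<longleftrightarrow> w = e x \<or> w = e y))"
    using assms by (simp add: fm_pair_def)
  also have "\<dots> \<longleftrightarrow> (\<forall>z\<in>V. z \<in> elts (e p) \<longleftrightarrow> z \<in> {vset {e x}, vset {e x, e y}})"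
    using * by simp
  also have "\<dots> \<longleftrightarrow> elts (e p) = elts (kpair (e x) (e y))"
    unfolding elts_kpair by (rule V_ext) (use assms pv in auto)
  finally show ?thesis by (simp add: elts_eq_iff)
qed

lemma sat_subset:
  "e x \<in> V \<Longrightarrow> x \<noteq> 3 \<Longrightarrow> y \<noteq> 3 \<Longrightarrow> sat V e (fm_subset x y) \<longleftrightarrow> elts (e x) \<subseteq> elts (e y)"
  by (auto simp: fm_subset_def)

lemma sat_transitive:
  assumes "e x \<in> V" "x \<noteq> 5" "x \<noteq> 6"
  shows "sat V e (fm_transitive x) \<longleftrightarrow> transitive (e x)"
proof -
  have "sat V e (fm_transitive x) \<longleftrightarrow>
      (\<forall>y\<in>V. y \<in> elts (e x) \<longrightarrow> (\<forall>z\<in>V. z \<in> elts y \<longrightarrow> z \<in> elts (e x)))"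
    using assms by (simp add: fm_transitive_def)
  then show ?thesis using V_mem assms(1) unfolding transitive_def by blast
qed

text \<open>V is closed under elements and subsets of its members, so the quantifiers over V lose
  nothing. The one existence claim is that of a history, and it must be found inside V.\<close>

lemma sat_level:
  assumes "e u \<in> V" "e a \<in> V" "10 \<le> u" "10 \<le> a"
  shows "sat V e (fm_level u a) \<longleftrightarrow> ordinal (e a) \<and> elts (e u) = Vlevel (e a)"
proof -
  have "sat V e (fm_level u a) \<longleftrightarrow>
      (\<exists>h\<in>V. (\<forall>x\<in>V. x \<in> elts h \<longrightarrow>
            (\<forall>z\<in>V. z \<in> elts x \<longleftrightarrow> (\<exists>y\<in>V. y \<in> elts h \<and> y \<in> elts x \<and> elts z \<subseteq> elts y))) \<and>
          (\<forall>z\<in>V. z \<in> elts (e u) \<longleftrightarrow> (\<exists>y\<in>V. y \<in> elts h \<and> elts z \<subseteq> elts y))) \<and>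
      (\<forall>z\<in>V. z \<in> elts (e a) \<longleftrightarrow> z \<in> elts (e u) \<and> transitive z \<and> (\<forall>x\<in>V. x \<in> elts z \<longrightarrow> transitive x))"
    using assms by (simp add: fm_level_def sat_subset sat_transitive del: V_ball V_bex cong: conj_cong)
  also have "\<dots> \<longleftrightarrow> (\<exists>h\<in>V. history h \<and> elts (e u) = {z. \<exists>y\<in>elts h. elts z \<subseteq> elts y}) \<and>
      elts (e a) = {z \<in> elts (e u). ordinal z}"
  proof -
    have "(\<forall>x\<in>V. x \<in> elts h \<longrightarrow>
        (\<forall>z\<in>V. z \<in> elts x \<longleftrightarrow> (\<exists>y\<in>V. y \<in> elts h \<and> y \<in> elts x \<and> elts z \<subseteq> elts y))) \<longleftrightarrow> history h"
      if h: "h \<in> V" for h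
    proof -
      have "(\<forall>z\<in>V. z \<in> elts x \<longleftrightarrow> (\<exists>y\<in>V. y \<in> elts h \<and> y \<in> elts x \<and> elts z \<subseteq> elts y)) \<longleftrightarrow>
          elts x = {z. \<exists>y\<in>elts h. y \<in> elts x \<and> elts z \<subseteq> elts y}" if "x \<in> V" for x
      proof -
        have "{z. \<exists>y\<in>elts h. y \<in> elts x \<and> elts z \<subseteq> elts y} \<subseteq> V"
          using Vlevel_downward[OF ord_L] V_mem[OF h] by blast
        from V_ext[OF that this] show ?thesis using h by simp
      qed
      then show ?thesis unfolding history_def V_ball[OF h, symmetric] by (intro ball_cong[OF refl]) (simp only:)
    qed
    moreover have "(\<forall>z\<in>V. z \<in> elts (e u) \<longleftrightarrow> (\<exists>y\<in>V. y \<in> elts h \<and> elts z \<subseteq> elts y)) \<longleftrightarrow>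
        elts (e u) = {z. \<exists>y\<in>elts h. elts z \<subseteq> elts y}" if h: "h \<in> V" for h
    proof -
      have "{z. \<exists>y\<in>elts h. elts z \<subseteq> elts y} \<subseteq> V"
        using Vlevel_downward[OF ord_L] V_mem[OF h] by blast
      from V_ext[OF assms(1) this] show ?thesis using h by simp
    qed
    moreover have "(\<forall>z\<in>V. z \<in> elts (e a) \<longleftrightarrow>
        z \<in> elts (e u) \<and> transitive z \<and> (\<forall>x\<in>V. x \<in> elts z \<longrightarrow> transitive x)) \<longleftrightarrow>
        elts (e a) = {z \<in> elts (e u). ordinal z}"
    proof -
      have "{z \<in> elts (e u). ordinal z} \<subseteq> V" using V_mem[OF assms(1)] by blast
      from V_ext[OF assms(2) this] show ?thesis by (simp add: ordinal_def cong: ball_cong)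
    qed
    ultimately show ?thesis by (simp cong: bex_cong)
  qed
  also have "\<dots> \<longleftrightarrow> ordinal (e a) \<and> elts (e u) = Vlevel (e a)" (is "?l \<longleftrightarrow> ?r")
  proof
    assume l: ?l
    then obtain h where h: "history h" "elts (e u) = {z. \<exists>y\<in>elts h. elts z \<subseteq> elts y}" by blast
    obtain \<delta> where \<delta>: "ordinal \<delta>" "elts (e u) = Vlevel \<delta>"
      using Un_Pow_levels[OF small_elts[of h] history_level[OF h(1)]] h(2) by auto
    have "elts (e a) = elts \<delta>"
      using l \<delta> ordinal_mem_Vlevel ordinal_mem by blast
    then show ?r using \<delta> elts_eq_iff by metis
  next
    assume r: ?r
    then have a: "e a \<in> elts \<Lambda>" using assms(2) ordinal_mem_Vlevel by blast
    \<comment> \<open>The history of V_\<alpha> consists of the levels V_\<beta> with \<beta> <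
      \<alpha>. All of these lie in V_\<alpha>, so it belongs to V.\<close>
    let ?h = "vset (Vset ` elts (e a))"
    have "Vset ` elts (e a) \<subseteq> Vlevel (e a)"
      using rank_Vset[OF ordinal_mem[of "e a"]] r by (auto simp: mem_Vlevel)
    then have "?h \<in> V" by (intro V_subset_level[OF a]) (simp add: elts_vset small_image)
    moreover have "elts (e a) = {z \<in> elts (e u). ordinal z}"
      using r ordinal_mem_Vlevel ordinal_mem by blast
    moreover have "elts (e u) = {z. \<exists>y\<in>elts ?h. elts z \<subseteq> elts y}"
      by (rule trans[OF conjunct2[OF r] history_levels(2)[OF conjunct1[OF r]]])
    moreover note history_levels(1)[OF conjunct1[OF r]]
    ultimately show ?l by blast
  qed
  finally show ?thesis .
qed

lemma sat_fm_of: "(\<And>i. e i \<in> V) \<Longrightarrow> sat V e (fm_of \<phi>) \<longleftrightarrow> bsat (\<lambda>i. e (i + 10)) \<phi>"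
proof (induction \<phi> arbitrary: e)
  case (BBall i k \<phi>)
  have "sat V (e(i + 10 := x)) (fm_of \<phi>) \<longleftrightarrow> bsat ((\<lambda>i. e (i + 10))(i := x)) \<phi>" if "x \<in> V" for x
  proof -
    have "(\<lambda>l. (e(i + 10 := x)) (l + 10)) = (\<lambda>i. e (i + 10))(i := x)" by auto
    moreover have "sat V (e(i + 10 := x)) (fm_of \<phi>) \<longleftrightarrow> bsat (\<lambda>l. (e(i + 10 := x)) (l + 10)) \<phi>"
      by (rule BBall.IH) (use BBall.prems that in auto)
    ultimately show ?thesis by (simp only:)
  qed
  then have "i \<noteq> k \<Longrightarrow> sat V e (fm_of (BBall i k \<phi>)) \<longleftrightarrow>
      (\<forall>x\<in>V. x \<in> elts (e (k + 10)) \<longrightarrow> bsat ((\<lambda>i. e (i + 10))(i := x)) \<phi>)"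
    by (simp del: V_ball cong: ball_cong)
  then show ?case using BBall.prems by (cases "i = k") simp_all
next
  case (BNeg \<phi>)
  then show ?case by simp
next
  case (BConj \<phi> \<psi>)
  then show ?case by simp
qed (simp_all add: sat_pair sat_level)

lemma elementary_bounded:
  assumes "elementary_embedding V k"
  shows "emb k"
  unfolding emb_def bounded_emb_def
proof (intro conjI allI impI)
  show fn: "is_function k V V" using assms unfolding elementary_embedding_def by blast
  then show sub: "val k ` V \<subseteq> V" using is_function_val by blast
  fix \<phi> :: "nat bfm" and e :: "nat \<Rightarrow> 'v"
  assume e: "\<forall>i. e i \<in> V"
  \<comment> \<open>The shift undoes that of \<open>fm_of\<close>. By truncated subtraction the
    auxiliary variables below 10 receive \<open>e 0\<close>, which lies in V.\<close>
  let ?e = "\<lambda>i. e (i - 10)"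
  have "sat V ?e (fm_of \<phi>) \<longleftrightarrow> sat V (\<lambda>i. val k (?e i)) (fm_of \<phi>)"
    by (rule assms[unfolded elementary_embedding_def, THEN conjunct2, rule_format]) (use e in simp)
  moreover have "sat V ?e (fm_of \<phi>) \<longleftrightarrow> bsat e \<phi>"
    using sat_fm_of[of ?e \<phi>] e by simp
  moreover have "sat V (\<lambda>i. val k (?e i)) (fm_of \<phi>) \<longleftrightarrow> bsat (val k \<circ> e) \<phi>"
    using sat_fm_of[of "\<lambda>i. val k (?e i)" \<phi>] e sub by (simp add: comp_def image_subset_iff)
  ultimately show "bsat e \<phi> \<longleftrightarrow> bsat (val k \<circ> e) \<phi>" by simp
qed

text \<open>Nontriviality must yield a moved ordinal, or there would be no critical point. By
  induction on rank: with \<alpha> = rank x, k(x) is contained in k(V_\<alpha>) = V_\<alpha>, whose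
  members k fixes.\<close>

lemma emb_fixes_all:
  assumes k: "emb k" and fixd: "\<And>\<alpha>. \<alpha> \<in> elts \<Lambda> \<Longrightarrow> val k \<alpha> = \<alpha>"
  shows "x \<in> V \<Longrightarrow> val k x = x"
proof (induction "rank x" arbitrary: x rule: elts_induct)
  case step
  let ?\<alpha> = "rank x"
  have f: "bounded_emb (val k)" using k emb_def by blast
  have \<alpha>: "?\<alpha> \<in> elts \<Lambda>" using step.prems by (simp add: mem_Vlevel)
  have "elts x \<subseteq> elts (Vset ?\<alpha>)" by (simp add: elts_Vset_L[OF \<alpha>] subset_Vlevel_iff)
  then have sub: "elts (val k x) \<subseteq> elts (Vset ?\<alpha>)"
    using emb_subset[OF f step.prems Vset_in_V[OF \<alpha>]] emb_Vset[OF f \<alpha>] fixd[OF \<alpha>] by simp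
  have "z \<in> elts (val k x) \<longleftrightarrow> z \<in> elts x" if "z \<in> elts (Vset ?\<alpha>)" for z
  proof -
    have "rank z \<in> elts ?\<alpha>" "z \<in> V"
      using that Vset_in_V[OF \<alpha>] V_mem by (auto simp: elts_Vset_L[OF \<alpha>] mem_Vlevel)
    then have "val k z = z" using step.hyps by blast
    then show ?thesis using emb_mem[OF f \<open>z \<in> V\<close> step.prems] by simp
  qed
  then have "elts (val k x) = elts x" using sub \<open>elts x \<subseteq> elts (Vset ?\<alpha>)\<close> by blast
  then show ?case by (simp add: elts_eq_iff)
qed

lemma nontrivial_moving: "k \<in> nontrivial_embeddings \<Lambda> \<Longrightarrow> moving k"
  using elementary_bounded emb_fixes_all unfolding nontrivial_embeddings_def moving_def by blast

end

section \<open>The algebra generated by one embedding\<close>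

lemma laver_homD:
  assumes "laver_hom \<Lambda> j N h"
  shows "h \<in> extensional (embedding_algebra \<Lambda> j)"
    and "h j = 1"
    and "\<And>a b. a \<in> embedding_algebra \<Lambda> j \<Longrightarrow> b \<in> embedding_algebra \<Lambda> j \<Longrightarrow>
           h (appl \<Lambda> a b) = laver0 N (h a) (h b)"
  using assms unfolding laver_hom_def by blast+

locale embedding_stage = limit_stage \<Lambda> for \<Lambda> :: "'v::zfc_universe" +
  fixes j :: 'v
  assumes j_nontrivial: "j \<in> nontrivial_embeddings \<Lambda>"
begin

abbreviation "A \<equiv> embedding_algebra \<Lambda> j"
abbreviation "C \<equiv> crit_points \<Lambda> j"

lemma A_moving: "k \<in> A \<Longrightarrow> moving k"
  by (induction rule: embedding_algebra.induct) (use nontrivial_moving j_nontrivial crit_appl in auto)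

lemma A_emb: "k \<in> A \<Longrightarrow> emb k" "k \<in> A \<Longrightarrow> bounded_emb (val k)"
  using A_moving moving_def emb_def by blast+

lemma A_crit: "k \<in> A \<Longrightarrow> crit \<Lambda> k \<in> elts \<Lambda>"
  using A_moving crit_props by blast

lemma A_crit_appl: "a \<in> A \<Longrightarrow> b \<in> A \<Longrightarrow> crit \<Lambda> (appl \<Lambda> a b) = val a (crit \<Lambda> b)"
  using A_moving crit_appl by blast

lemma A_val_mem_iff:
  "k \<in> A \<Longrightarrow> \<alpha> \<in> elts \<Lambda> \<Longrightarrow> \<beta> \<in> elts \<Lambda> \<Longrightarrow> val k \<alpha> \<in> elts (val k \<beta>) \<longleftrightarrow> \<alpha> \<in> elts \<beta>"
  using emb_mem A_emb ordinals_in_V by blast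

section \<open>Enumeration of the critical points\<close>

definition below :: "'v \<Rightarrow> 'v set" where
  "below \<alpha> = {\<beta> \<in> C. \<beta> \<in> elts \<alpha>}"

definition index :: "'v \<Rightarrow> enat" where
  "index \<alpha> = (if finite (below \<alpha>) then enat (card (below \<alpha>)) else \<infinity>)"

lemma C_ord: "\<alpha> \<in> C \<Longrightarrow> \<alpha> \<in> elts \<Lambda>" "\<alpha> \<in> C \<Longrightarrow> ordinal \<alpha>"
  using A_crit ord by (auto simp: crit_points_def)

lemma index_less:
  assumes "\<alpha> \<in> C" "\<beta> \<in> C" "\<alpha> \<in> elts \<beta>"
  shows "eSuc (index \<alpha>) \<le> index \<beta>"
proof (cases "finite (below \<beta>)")
  case True
  have sub: "insert \<alpha> (below \<alpha>) \<subseteq> below \<beta>"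
    using assms ordinal_trans[OF C_ord(2)[OF assms(2)]] by (auto simp: below_def)
  have "\<alpha> \<notin> below \<alpha>" by (simp add: below_def mem_not_refl)
  moreover have "finite (below \<alpha>)" using finite_subset[OF sub True] by simp
  ultimately have "Suc (card (below \<alpha>)) \<le> card (below \<beta>)"
    using card_mono[OF True sub] by simp
  then show ?thesis using True \<open>finite (below \<alpha>)\<close> by (simp add: index_def eSuc_enat)
qed (simp add: index_def)

lemma index_le: "\<alpha> \<in> C \<Longrightarrow> \<beta> \<in> C \<Longrightarrow> \<alpha> \<in> elts \<beta> \<or> \<alpha> = \<beta> \<Longrightarrow> index \<alpha> \<le> index \<beta>"
  using order_trans[OF ile_eSuc index_less] by auto

lemma index_less_D: "\<alpha> \<in> C \<Longrightarrow> \<beta> \<in> C \<Longrightarrow> index \<alpha> < index \<beta> \<Longrightarrow> \<alpha> \<in> elts \<beta>"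
  using ordinal_linear[OF C_ord(2) C_ord(2), of \<alpha> \<beta>] index_le[of \<beta> \<alpha>] by auto

lemma index_inj:
  assumes "\<alpha> \<in> C" "\<beta> \<in> C" "index \<alpha> = enat i" "index \<beta> = enat i"
  shows "\<alpha> = \<beta>"
  using ordinal_linear[OF C_ord(2) C_ord(2), OF assms(1,2)] index_less[of \<alpha> \<beta>] index_less[of \<beta> \<alpha>] assms
  by (auto simp: eSuc_enat)

lemma C_least:
  assumes "\<alpha> \<in> C" "P \<alpha>"
  obtains \<beta> where "\<beta> \<in> C" "P \<beta>" "\<And>\<delta>. \<delta> \<in> C \<Longrightarrow> P \<delta> \<Longrightarrow> \<delta> \<notin> elts \<beta>"
proof -
  have "\<alpha> \<in> {\<alpha> \<in> C. P \<alpha>}" using assms by simp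
  then show thesis
  proof (rule wfE_min[OF foundation])
    fix \<beta>
    assume \<beta>: "\<beta> \<in> {\<alpha> \<in> C. P \<alpha>}"
      "\<And>\<delta>. (\<delta>, \<beta>) \<in> {(x, y). x \<in> elts y} \<Longrightarrow> \<delta> \<notin> {\<alpha> \<in> C. P \<alpha>}"
    have "\<delta> \<notin> elts \<beta>" if "\<delta> \<in> C" "P \<delta>" for \<delta> using \<beta>(2)[of \<delta>] that by auto
    then show thesis using that[of \<beta>] \<beta>(1) by simp
  qed
qed

lemma crit_in_C: "k \<in> A \<Longrightarrow> crit \<Lambda> k \<in> C"
  by (simp add: crit_points_def)

lemma val_crit_in_C: "a \<in> A \<Longrightarrow> x \<in> A \<Longrightarrow> val a (crit \<Lambda> x) \<in> C"
  using crit_in_C[OF embedding_algebra.application, of a x] A_crit_appl by simp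

lemma C_unbounded:
  assumes "\<alpha> \<in> C"
  shows "\<exists>\<beta>\<in>C. \<alpha> \<in> elts \<beta>"
proof -
  obtain k where k: "k \<in> A" "\<alpha> = crit \<Lambda> k" using assms by (auto simp: crit_points_def)
  have "\<alpha> \<in> elts (crit \<Lambda> (appl \<Lambda> k k))"
    using k A_crit_appl crit_less_val A_moving by simp
  then show ?thesis using crit_in_C[OF embedding_algebra.application[OF k(1) k(1)]] by blast
qed

text \<open>There is no largest critical point, because crit (k \<cdot> k) > crit k; the least one
  above \<gamma>_i has exactly one more below it.\<close>

lemma index_onto: "\<exists>\<alpha>\<in>C. index \<alpha> = enat i"
proof (induction i)
  case 0
  obtain \<beta> where \<beta>: "\<beta> \<in> C" "\<And>\<delta>. \<delta> \<in> C \<Longrightarrow> \<delta> \<notin> elts \<beta>"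
    by (rule C_least[of "crit \<Lambda> j" "\<lambda>_. True"]) (use crit_in_C[OF embedding_algebra.generator] in auto)
  then have "below \<beta> = {}" by (auto simp: below_def)
  then show ?case using \<beta>(1) by (intro bexI[of _ \<beta>]) (simp_all add: index_def)
next
  case (Suc i)
  then obtain \<alpha> where \<alpha>: "\<alpha> \<in> C" "index \<alpha> = enat i" by blast
  obtain \<alpha>' where "\<alpha>' \<in> C" "\<alpha> \<in> elts \<alpha>'" using C_unbounded \<alpha> by blast
  then obtain \<beta> where \<beta>: "\<beta> \<in> C" "\<alpha> \<in> elts \<beta>" "\<And>\<delta>. \<delta> \<in> C \<Longrightarrow> \<alpha> \<in> elts \<delta> \<Longrightarrow> \<delta> \<notin> elts \<beta>"
    by (rule C_least[of \<alpha>' "\<lambda>\<delta>. \<alpha> \<in> elts \<delta>"]) auto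
  have "below \<beta> = insert \<alpha> (below \<alpha>)"
  proof (intro set_eqI iffI)
    fix \<delta> assume "\<delta> \<in> below \<beta>"
    then have \<delta>: "\<delta> \<in> C" "\<delta> \<in> elts \<beta>" by (auto simp: below_def)
    then show "\<delta> \<in> insert \<alpha> (below \<alpha>)"
      using \<beta>(3)[OF \<delta>(1)] ordinal_linear[OF C_ord(2)[OF \<delta>(1)] C_ord(2)[OF \<alpha>(1)]]
      unfolding below_def by blast
  next
    fix \<delta> assume "\<delta> \<in> insert \<alpha> (below \<alpha>)"
    then show "\<delta> \<in> below \<beta>"
      using \<alpha>(1) \<beta>(1,2) ordinal_trans[OF C_ord(2)[OF \<beta>(1)]] unfolding below_def by blast
  qed
  moreover have "\<alpha> \<notin> below \<alpha>" by (simp add: below_def mem_not_refl)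
  ultimately have "index \<beta> = enat (Suc i)"
    using \<alpha>(2) by (auto simp: index_def split: if_splits)
  then show ?case using \<beta>(1) by blast
qed

definition c :: "'v \<Rightarrow> enat" where
  "c k = index (crit \<Lambda> k)"

lemma c_ge_self:
  assumes "a \<in> A" "x \<in> A"
  shows "c x \<le> c (appl \<Lambda> a x)"
proof -
  have "crit \<Lambda> x \<in> elts (val a (crit \<Lambda> x)) \<or> crit \<Lambda> x = val a (crit \<Lambda> x)"
    using emb_ge A_emb A_crit assms by blast
  then show ?thesis unfolding c_def
    by (intro index_le) (use assms A_crit_appl crit_in_C val_crit_in_C in auto)
qed

sublocale crit_algebra A "appl \<Lambda>" j c
proof
  show "j \<in> A" by (rule embedding_algebra.generator)
  show "appl \<Lambda> a b \<in> A" if "a \<in> A" "b \<in> A" for a b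
    using that by (rule embedding_algebra.application)
  show "P k" if "k \<in> A" "P j"
    "\<And>a b. a \<in> A \<Longrightarrow> b \<in> A \<Longrightarrow> P a \<Longrightarrow> P b \<Longrightarrow> P (appl \<Lambda> a b)" for k P
    using that(1) by (induction rule: embedding_algebra.induct) (use that(2,3) in auto)
  show "appl \<Lambda> x (appl \<Lambda> y z) = appl \<Lambda> (appl \<Lambda> x y) (appl \<Lambda> x z)"
    if "x \<in> A" "y \<in> A" "z \<in> A" for x y z
    using that appl_ldist A_emb by blast
  show "eSuc (c (appl \<Lambda> a x)) \<le> c (appl \<Lambda> a y)" if "a \<in> A" "x \<in> A" "y \<in> A" "c x < c y" for a x y
  proof -
    have "crit \<Lambda> x \<in> elts (crit \<Lambda> y)"
      using that index_less_D crit_in_C unfolding c_def by blast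
    then show ?thesis unfolding c_def
      by (intro index_less) (use that crit_in_C val_crit_in_C A_crit_appl A_val_mem_iff A_crit in auto)
  qed
  show "c (appl \<Lambda> a x) = c (appl \<Lambda> a y)" if "a \<in> A" "x \<in> A" "y \<in> A" "c x = c y" for a x y
  proof (cases "c x")
    case (enat i)
    then have "crit \<Lambda> x = crit \<Lambda> y"
      using that crit_in_C index_inj[of "crit \<Lambda> x" "crit \<Lambda> y" i] unfolding c_def by simp
    then show ?thesis unfolding c_def using that A_crit_appl by simp
  next
    \<comment> \<open>Infinite index does not determine the critical point, but application cannot
      lower the index, so both values are infinite.\<close>
    case infinity
    then show ?thesis using c_ge_self[OF that(1,2)] c_ge_self[OF that(1,3)] that(4) by simp
  qed
  show "c (appl \<Lambda> a x) = c x" if "a \<in> A" "x \<in> A" "c x < c a" for a x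
  proof -
    have "crit \<Lambda> x \<in> elts (crit \<Lambda> a)"
      using that index_less_D crit_in_C unfolding c_def by blast
    then show ?thesis unfolding c_def
      using that A_crit_appl crit_props(3)[OF A_moving] by simp
  qed
  show "eSuc (c a) \<le> c (appl \<Lambda> a a)" if "a \<in> A" for a
    unfolding c_def
    by (intro index_less) (use that crit_in_C val_crit_in_C A_crit_appl crit_less_val A_moving in auto)
  show "c x \<le> c (appl \<Lambda> a x)" if "a \<in> A" "x \<in> A" for a x using c_ge_self that .
  show "\<exists>x\<in>A. c x = enat i" for i
    using index_onto[of i] by (auto simp: crit_points_def c_def)
qed

section \<open>Return to \<open>gamma\<close> and \<open>emb_mod\<close>\<close>

lemma gamma_eq:
  assumes "k \<in> A" "c k = enat i"
  shows "gamma \<Lambda> j i = crit \<Lambda> k"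
  unfolding gamma_def ord_less_def below_def[symmetric]
proof (rule the_equality)
  show "crit \<Lambda> k \<in> C \<and> finite (below (crit \<Lambda> k)) \<and> card (below (crit \<Lambda> k)) = i"
    using assms crit_in_C by (auto simp: c_def index_def split: if_splits)
  then show "\<alpha> = crit \<Lambda> k" if "\<alpha> \<in> C \<and> finite (below \<alpha>) \<and> card (below \<alpha>) = i" for \<alpha>
    using that index_inj[of \<alpha> "crit \<Lambda> k" i] by (simp add: index_def)
qed

lemma gamma_lp: "gamma \<Lambda> j i = crit \<Lambda> (lp j (2 ^ i))"
  by (rule gamma_eq) (simp_all add: c_lp_pow)

lemma val_gamma: "k \<in> A \<Longrightarrow> val k (gamma \<Lambda> j i) = crit \<Lambda> (appl \<Lambda> k (lp j (2 ^ i)))"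
  by (simp add: gamma_lp A_crit_appl)

lemma maps_to_gamma: "k \<in> A \<Longrightarrow> maps_to k i m \<Longrightarrow> val k (gamma \<Lambda> j i) = gamma \<Lambda> j m"
  using gamma_eq[of "appl \<Lambda> k (lp j (2 ^ i))" m] by (simp add: val_gamma maps_to_def app_in)

lemma gamma_le:
  assumes "k \<in> A" "enat m \<le> c k"
  shows "ord_le (gamma \<Lambda> j m) (crit \<Lambda> k)"
proof -
  let ?g = "lp j (2 ^ m)"
  have "\<not> crit \<Lambda> k \<in> elts (crit \<Lambda> ?g)"
  proof
    assume "crit \<Lambda> k \<in> elts (crit \<Lambda> ?g)"
    then have "eSuc (c k) \<le> c ?g" unfolding c_def using index_less assms(1) crit_in_C lp_j_in by blast
    then show False using assms(2) c_lp_pow[of m] by (cases "c k") (auto simp: eSuc_enat)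
  qed
  then show ?thesis unfolding ord_le_def gamma_lp
    using ordinal_linear[OF C_ord(2) C_ord(2), OF crit_in_C[OF assms(1)] crit_in_C[OF lp_j_in]] by metis
qed

lemma gamma_less:
  assumes "k \<in> A" "enat m < c k"
  shows "ord_less (gamma \<Lambda> j m) (crit \<Lambda> k)"
  unfolding ord_less_def gamma_lp
  by (rule index_less_D) (use assms crit_in_C c_lp_pow in \<open>auto simp: c_def[symmetric]\<close>)

lemma left_power_lp: "left_power \<Lambda> j r = lp j r"
proof (induction r)
  case (Suc r)
  then show ?case by (cases r) auto
qed simp

lemma laver_hom_md:
  assumes "1 \<le> N"
  shows "laver_hom \<Lambda> j N (\<lambda>k\<in>A. if md N k = 2 ^ N then 0 else md N k)"
proof -
  let ?h = "\<lambda>k. if md N k = 2 ^ N then 0 else md N k"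
  have "?h ` A = {0..<2 ^ N}"
  proof (intro equalityI subsetI)
    fix r assume "r \<in> ?h ` A"
    then show "r \<in> {0..<2 ^ N}" using md[of _ N] by (auto split: if_splits intro: le_neq_implies_less)
  next
    fix r :: nat assume r: "r \<in> {0..<2 ^ N}"
    let ?p = "if r = 0 then 2 ^ N else r"
    have "md N (lp j ?p) = ?p" using r by (intro md_lp) auto
    then have "r = ?h (lp j ?p)" using r by auto
    then show "r \<in> ?h ` A" by (rule image_eqI[OF _ lp_j_in])
  qed
  moreover have "?h j = 1"
  proof -
    have "md N j = 1" using md_lp[of 1 N] by simp
    \<comment> \<open>For N = 0 the residue 1 would itself be the one renamed 0.\<close>
    moreover have "(2::nat) ^ N \<noteq> 1" using assms by simp
    ultimately show ?thesis by metis
  qed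
  moreover have "?h (appl \<Lambda> a b) = laver0 N (?h a) (?h b)" if "a \<in> A" "b \<in> A" for a b
    using md[OF that(1), of N] md[OF that(2), of N] by (simp add: md_app[OF that] laver0_def Let_def)
  ultimately show ?thesis
    unfolding laver_hom_def by (auto simp: j_in app_in)
qed

text \<open>A homomorphism is determined on the algebra by its value at the generator, and outside
  by extensionality, so the description picks out the map of \<open>laver_hom_md\<close>.\<close>

lemma emb_mod_md:
  assumes "1 \<le> N" "k \<in> A"
  shows "emb_mod \<Lambda> j N k = (if md N k = 2 ^ N then 0 else md N k)"
proof -
  let ?h = "\<lambda>k\<in>A. if md N k = 2 ^ N then 0 else md N k"
  have "(THE h. laver_hom \<Lambda> j N h) = ?h"
  proof (rule the_equality[where P = "laver_hom \<Lambda> j N", OF laver_hom_md[OF assms(1)]])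
    fix h assume h: "laver_hom \<Lambda> j N h"
    note g = laver_hom_md[OF assms(1)]
    have "h k = ?h k" if "k \<in> A" for k
    proof (rule generated[OF that])
      show "h j = ?h j" unfolding laver_homD(2)[OF h] laver_homD(2)[OF g] ..
    next
      fix a b assume ab: "a \<in> A" "b \<in> A" and eq: "h a = ?h a" "h b = ?h b"
      show "h (appl \<Lambda> a b) = ?h (appl \<Lambda> a b)"
        unfolding laver_homD(3)[OF h ab] laver_homD(3)[OF g ab] eq ..
    qed
    then show "h = ?h" by (rule extensionalityI[OF laver_homD(1)[OF h] laver_homD(1)[OF g]])
  qed
  then show ?thesis unfolding emb_mod_def using assms(2) by simp
qed

end

theorem theorem3p1:
  fixes \<Lambda> j :: "'v::zfc_universe" and n :: nat
  assumes "limit_ordinal \<Lambda>"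
    and "j \<in> nontrivial_embeddings \<Lambda>"
  shows
    "(\<forall>m<n. \<exists>\<kappa>\<in>embedding_algebra \<Lambda> j.
        crit \<Lambda> \<kappa> = gamma \<Lambda> j (2 ^ n - 2 ^ (m + 1)) \<and>
        val \<kappa> (gamma \<Lambda> j (2 ^ n - 2 ^ (m + 1))) = gamma \<Lambda> j (2 ^ n - 2 ^ m) \<and>
        val \<kappa> (gamma \<Lambda> j (2 ^ n - 2 ^ m)) = gamma \<Lambda> j (2 ^ n)) \<and>
     (\<forall>k\<in>embedding_algebra \<Lambda> j. emb_mod \<Lambda> j (2 ^ n) k \<noteq> 0 \<longrightarrow>
        ord_le (gamma \<Lambda> j (2 ^ (n + 1))) (val k (gamma \<Lambda> j (2 ^ n))) \<and>
        (emb_mod \<Lambda> j (2 ^ (n + 1)) k > 2 ^ 2 ^ n \<longrightarrow>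
           ord_less (gamma \<Lambda> j (2 ^ (n + 1))) (val k (gamma \<Lambda> j (2 ^ n))))) \<and>
     (let l = left_power \<Lambda> j (2 ^ 2 ^ n - 1) in
        crit \<Lambda> l = gamma \<Lambda> j 0 \<and>
        val l (gamma \<Lambda> j 0) = gamma \<Lambda> j (2 ^ n) \<and>
        val l (gamma \<Lambda> j (2 ^ n)) = gamma \<Lambda> j (2 ^ (n + 1)))"
proof -
  interpret embedding_stage \<Lambda> j
    using assms by unfold_locales
  let ?K = "2 ^ n :: nat"
  note ch = chain_exists[of n]
  have a: "\<exists>\<kappa>\<in>A. crit \<Lambda> \<kappa> = gamma \<Lambda> j (?K - 2 ^ (m + 1)) \<and>
      val \<kappa> (gamma \<Lambda> j (?K - 2 ^ (m + 1))) = gamma \<Lambda> j (?K - 2 ^ m) \<and>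
      val \<kappa> (gamma \<Lambda> j (?K - 2 ^ m)) = gamma \<Lambda> j ?K" if mn: "m < n" for m
  proof -
    obtain k where k: "k \<in> A" "c k = enat (?K - 2 ^ (m + 1))"
      "maps_to k (?K - 2 ^ (m + 1)) (?K - 2 ^ m)" "maps_to k (?K - 2 ^ m) ?K"
      using ch mn unfolding chain_exists_def by blast
    then show ?thesis
      using maps_to_gamma[OF k(1,3)] maps_to_gamma[OF k(1,4)] gamma_eq[OF k(1,2)]
      by (intro bexI[OF _ k(1)]) simp
  qed
  have b: "ord_le (gamma \<Lambda> j (2 ^ (n + 1))) (val k (gamma \<Lambda> j ?K)) \<and>
      (emb_mod \<Lambda> j (2 ^ (n + 1)) k > 2 ^ ?K \<longrightarrow>
        ord_less (gamma \<Lambda> j (2 ^ (n + 1))) (val k (gamma \<Lambda> j ?K)))"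
    if k: "k \<in> A" and nz: "emb_mod \<Lambda> j ?K k \<noteq> 0" for k
  proof -
    have K2: "2 ^ (n + 1) = 2 * ?K" by simp
    have "md ?K k < 2 ^ ?K"
      using nz md[OF k, of ?K] emb_mod_md[OF _ k, of ?K] by (auto split: if_splits intro: le_neq_implies_less)
    then have ck: "c k < enat ?K" using c_less_iff_md[OF k] by blast
    have kA: "appl \<Lambda> k (lp j (2 ^ ?K)) \<in> A" using app_in[OF k lp_j_in] .
    have "ord_le (gamma \<Lambda> j (2 * ?K)) (val k (gamma \<Lambda> j ?K))"
      unfolding val_gamma[OF k] by (rule gamma_le[OF kA value_ge[OF ch refl k ck]])
    moreover have "ord_less (gamma \<Lambda> j (2 * ?K)) (val k (gamma \<Lambda> j ?K))"
      if m: "emb_mod \<Lambda> j (2 * ?K) k > 2 ^ ?K"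
    proof -
      \<comment> \<open>A positive \<open>emb_mod\<close> is not the renamed residue, so it equals
        \<open>md\<close>.\<close>
      have "2 ^ ?K < md (2 * ?K) k"
        using m emb_mod_md[OF _ k, of "2 * ?K"] by (auto split: if_splits)
      then have "enat (Suc (2 * ?K)) \<le> c (appl \<Lambda> k (lp j (2 ^ ?K)))"
        by (rule value_gt[OF ch refl k ck])
      then show ?thesis unfolding val_gamma[OF k] by (intro gamma_less[OF kA]) (simp add: Suc_ile_eq)
    qed
    ultimately show ?thesis unfolding K2 by blast
  qed
  let ?l = "lp j (2 ^ ?K - 1)"
  note l = left_power_values[OF ch refl]
  have "crit \<Lambda> ?l = gamma \<Lambda> j 0 \<and> val ?l (gamma \<Lambda> j 0) = gamma \<Lambda> j ?K \<and>
      val ?l (gamma \<Lambda> j ?K) = gamma \<Lambda> j (2 ^ (n + 1))"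
    using gamma_eq[OF lp_j_in, of _ 0] maps_to_gamma[OF lp_j_in l(2)] maps_to_gamma[OF lp_j_in l(3)] l(1)
    by (simp add: zero_enat_def)
  then show ?thesis unfolding Let_def left_power_lp using a b by blast
qed

end
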